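(* There exist constants $\tilde\epsilon=\tilde\epsilon(n)>0$ and $\tilde C=\tilde C(n)>0$ such that the following holds. Let $h\in C^{2,1}(\mathbb{R}^n\times[0,\infty))$ be a solution of the Ricci DeTurck equation satisfying (i) $\|h\|_{L^\infty(\mathbb{R}^n\times(0,\infty))}<\tilde\epsilon$ and (ii) $\|h_0\|_{L^p(\mathbb{R}^n)}<\infty$ for some $1\leq p<\infty$, where $h_0=h(\cdot,0)$. Then $$\|h_t\|_{L^p(\mathbb{R}^n)}\leq\tilde C\|h_0\|_{L^p(\mathbb{R}^n)}\quad\text{for all } t\geq 0.$$ If $p\geq 2$ one can take $\tilde C=1$.
   Context: Let $\delta=g_{eucl}$ be the Euclidean metric on $\mathbb{R}^n$; norms, $\nabla$ and $\Delta$ are Euclidean, and $(\delta+h)^{ab}$ is the inverse matrix of $\delta_{ab}+h_{ab}$. The Ricci DeTurck equation for a time-dependent symmetric 2-tensor $h=h_t$ is $$(\partial_t-\Delta)h_{ij}=Q_0[h]_{ij}+\nabla_a(Q_1[h]^a_{ij}),$$ $Q_0[h]_{ij}=\tfrac12(\delta+h)^{ab}(\delta+h)^{pq}(\nabla_i h_{pa}\nabla_j h_{qb}+2\nabla_a h_{jp}\nabla_q h_{ib}-2\nabla_a h_{jp}\nabla_b h_{iq}-2\nabla_j h_{pa}\nabla_b h_{iq}-2\nabla_i h_{pa}\nabla_b h_{jq})-\nabla_a(\delta+h)^{ab}\nabla_b h_{ij}$, $Q_1[h]^a_{ij}=((\delta+h)^{ab}-\delta^{ab})\nabla_b h_{ij}$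 (summation convention). $C^{2,1}$ means two continuous spatial derivatives and one continuous time derivative. *)

theory Defs
  imports "HOL-Analysis.Analysis"
begin

text \<open>Tensors on R^n: points are real^'n, symmetric 2-tensors are matrices real^'n^'n.
  A time-dependent tensor field is h :: real^'n \<Rightarrow> real \<Rightarrow> real^'n^'n, h x t = h_t(x).
  The norm on real^'n^'n is the Frobenius (Euclidean tensor) norm.\<close>

definition pdx :: "'n::finite \<Rightarrow> (real^'n \<Rightarrow> 'b::real_normed_vector) \<Rightarrow> real^'n \<Rightarrow> 'b" where
  "pdx i f x = vector_derivative (\<lambda>s. f (x + s *\<^sub>R axis i 1)) (at 0)"

definition pdt :: "(real^'n::finite \<Rightarrow> real \<Rightarrow> 'b::real_normed_vector) \<Rightarrow> real^'n \<Rightarrow> real \<Rightarrow> 'b" where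
  "pdt h x t = vector_derivative (\<lambda>s. h x s) (at t within {0..})"

definition C21 :: "(real^'n::finite \<Rightarrow> real \<Rightarrow> real^'n^'n) \<Rightarrow> bool" where
  "C21 h \<longleftrightarrow>
     continuous_on (UNIV \<times> {0..}) (\<lambda>(x,t). h x t) \<and>
     (\<forall>i x t. t \<ge> 0 \<longrightarrow>
        ((\<lambda>s. h (x + s *\<^sub>R axis i 1) t) has_vector_derivative pdx i (\<lambda>y. h y t) x) (at 0)) \<and>
     (\<forall>i. continuous_on (UNIV \<times> {0..}) (\<lambda>(x,t). pdx i (\<lambda>y. h y t) x)) \<and>
     (\<forall>i j x t. t \<ge> 0 \<longrightarrow>
        ((\<lambda>s. pdx j (\<lambda>y. h y t) (x + s *\<^sub>R axis i 1)) has_vector_derivative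
            pdx i (pdx j (\<lambda>y. h y t)) x) (at 0)) \<and>
     (\<forall>i j. continuous_on (UNIV \<times> {0..}) (\<lambda>(x,t). pdx i (pdx j (\<lambda>y. h y t)) x)) \<and>
     (\<forall>x t. t \<ge> 0 \<longrightarrow> ((\<lambda>s. h x s) has_vector_derivative pdt h x t) (at t within {0..})) \<and>
     continuous_on (UNIV \<times> {0..}) (\<lambda>(x,t). pdt h x t)"

definition ginv :: "(real^'n::finite \<Rightarrow> real \<Rightarrow> real^'n^'n) \<Rightarrow> real^'n \<Rightarrow> real \<Rightarrow> real^'n^'n" where
  "ginv h x t = matrix_inv (mat 1 + h x t)"

definition Dh :: "(real^'n::finite \<Rightarrow> real \<Rightarrow> real^'n^'n) \<Rightarrow> 'n \<Rightarrow> 'n \<Rightarrow> 'n \<Rightarrow> real^'n \<Rightarrow> real \<Rightarrow> real" where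
  "Dh h c i j x t = pdx c (\<lambda>y. h y t) x $ i $ j"

definition Q0 :: "(real^'n::finite \<Rightarrow> real \<Rightarrow> real^'n^'n) \<Rightarrow> 'n \<Rightarrow> 'n \<Rightarrow> real^'n \<Rightarrow> real \<Rightarrow> real" where
  "Q0 h i j x t =
     (1/2) * (\<Sum>a\<in>UNIV. \<Sum>b\<in>UNIV. \<Sum>p\<in>UNIV. \<Sum>q\<in>UNIV.
        ginv h x t $ a $ b * ginv h x t $ p $ q *
        (Dh h i p a x t * Dh h j q b x t
         + 2 * Dh h a j p x t * Dh h q i b x t
         - 2 * Dh h a j p x t * Dh h b i q x t
         - 2 * Dh h j p a x t * Dh h b i q x t
         - 2 * Dh h i p a x t * Dh h b j q x t))
     - (\<Sum>a\<in>UNIV. \<Sum>b\<in>UNIV. pdx a (\<lambda>y. ginv h y t) x $ a $ b * Dh h b i j x t)"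

definition Q1 :: "(real^'n::finite \<Rightarrow> real \<Rightarrow> real^'n^'n) \<Rightarrow> 'n \<Rightarrow> 'n \<Rightarrow> 'n \<Rightarrow> real^'n \<Rightarrow> real \<Rightarrow> real" where
  "Q1 h a i j x t = (\<Sum>b\<in>UNIV. (ginv h x t $ a $ b - mat 1 $ a $ b) * Dh h b i j x t)"

definition ricci_deturck :: "(real^'n::finite \<Rightarrow> real \<Rightarrow> real^'n^'n) \<Rightarrow> bool" where
  "ricci_deturck h \<longleftrightarrow>
     (\<forall>x t i j. t \<ge> 0 \<longrightarrow>
        pdt h x t $ i $ j - (\<Sum>a\<in>UNIV. pdx a (pdx a (\<lambda>y. h y t)) x $ i $ j)
        = Q0 h i j x t + (\<Sum>a\<in>UNIV. pdx a (\<lambda>y. Q1 h a i j y t) x))"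

definition Lp_norm :: "real \<Rightarrow> (real^'n::finite \<Rightarrow> real^'n^'n) \<Rightarrow> real" where
  "Lp_norm p f = (\<integral>x. norm (f x) powr p \<partial>lborel) powr (1/p)"

definition Lp_finite :: "real \<Rightarrow> (real^'n::finite \<Rightarrow> real^'n^'n) \<Rightarrow> bool" where
  "Lp_finite p f \<longleftrightarrow> f \<in> borel_measurable lborel \<and> integrable lborel (\<lambda>x. norm (f x) powr p)"

end

theory Submission
  imports Defs
begin

text \<open>In nondivergence form the equation reads \<open>\<partial>\<^sub>t h = (\<delta> + h)\<^sup>a\<^sup>b \<nabla>\<^sub>a \<nabla>\<^sub>b h + N\<close> with \<open>N\<close> quadratic in
  \<open>\<nabla>h\<close>. Hence, for \<open>q = p/2\<close> and \<open>v = |h|\<^sup>2 + \<eta>\<close>, a function \<open>F = G v - G \<eta>\<close> satisfies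
  \<open>\<partial>\<^sub>t F \<le> (\<delta> + h)\<^sup>a\<^sup>b \<nabla>\<^sub>a \<nabla>\<^sub>b F + (4 |h|\<^sup>2 (G'')\<^sup>- - 2 G' + c |h| G') |\<nabla>h|\<^sup>2\<close>. For \<open>q \<ge> 1\<close> the last factor
  is nonpositive with \<open>G v = v\<^sup>q\<close>; for \<open>q < 1\<close>, where the quadratic terms can no longer be absorbed when
  \<open>p\<close> is close to 1, it is nonpositive with \<open>G v = v\<^sup>q + k v\<^sup>q\<^sup>+\<^sup>1\<^sup>/\<^sup>2\<close> and large \<open>k\<close>, which still is comparable
  to \<open>|h|\<^sup>p\<close>.

  Testing with a compactly supported weight \<open>\<phi>\<close>, one integrates \<open>\<Delta>F\<close> by parts twice but
  \<open>((\<delta> + h)\<^sup>a\<^sup>b - \<delta>\<^sup>a\<^sup>b) \<nabla>\<^sub>a \<nabla>\<^sub>b F\<close> only once; every error term with \<open>\<nabla>h\<close> then carries a factor \<open>|h|\<close> and is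
  absorbed, so no bound on \<open>\<nabla>h\<close> at infinity is needed. The weight \<open>\<phi> = (1 - |x|\<^sup>2/R\<^sup>2)\<^sub>+\<^sup>2\<^sup>n\<^sup>+\<^sup>2\<close> has
  \<open>|\<nabla>\<phi>|\<^sup>2 \<le> \<phi> \<omega>\<close> and \<open>|\<Delta>\<phi>| \<le> \<omega>\<close> with \<open>\<omega> \<le> \<mu> \<phi> + o(R\<^sup>-\<^sup>n)\<close> for every \<open>\<mu> > 0\<close>. Gronwall's inequality and the
  limits \<open>\<eta> \<rightarrow> 0\<close>, \<open>R \<rightarrow> \<infinity>\<close>, \<open>\<mu> \<rightarrow> 0\<close> (in this order) show that \<open>\<integral> G(|h|\<^sup>2)\<close> does not exceed its
  initial value.\<close>

section \<open>Partial derivatives and integration by parts\<close>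

text \<open>\<open>pdx\<close> has some value even where no derivative exists. This relation carries
  existence along, so that the calculus rules can be chained; \<open>has_pd_pdx\<close> recovers the
  value at the end.\<close>

definition has_pd :: "(real^'n::finite \<Rightarrow> 'b::real_normed_vector) \<Rightarrow> 'b \<Rightarrow> 'n \<Rightarrow> real^'n \<Rightarrow> bool" where
  "has_pd f f' i x \<longleftrightarrow> ((\<lambda>s. f (x + s *\<^sub>R axis i 1)) has_vector_derivative f') (at 0)"

lemma has_pd_pdx: "has_pd f f' i x \<Longrightarrow> pdx i f x = f'"
  unfolding has_pd_def pdx_def by (rule vector_derivative_at)

lemma has_pd_eq: "has_pd f f' i x \<Longrightarrow> f' = g' \<Longrightarrow> has_pd f g' i x"
  by simp

lemma has_pd_const: "has_pd (\<lambda>x. c) 0 i x"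
  by (auto simp: has_pd_def intro!: derivative_eq_intros)

lemma has_pd_add: "has_pd f f' i x \<Longrightarrow> has_pd g g' i x \<Longrightarrow> has_pd (\<lambda>x. f x + g x) (f' + g') i x"
  by (auto simp: has_pd_def intro!: derivative_eq_intros)

lemma has_pd_diff: "has_pd f f' i x \<Longrightarrow> has_pd g g' i x \<Longrightarrow> has_pd (\<lambda>x. f x - g x) (f' - g') i x"
  by (auto simp: has_pd_def intro!: derivative_eq_intros)

lemma has_pd_sum: "(\<And>j. j \<in> S \<Longrightarrow> has_pd (f j) (f' j) i x) \<Longrightarrow>
   has_pd (\<lambda>x. \<Sum>j\<in>S. f j x) (\<Sum>j\<in>S. f' j) i x"
  by (auto simp: has_pd_def intro!: has_vector_derivative_sum)

lemma has_pd_bilinear: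
  assumes "bounded_bilinear pr" "has_pd f f' i x" "has_pd g g' i x"
  shows "has_pd (\<lambda>x. pr (f x) (g x)) (pr (f x) g' + pr f' (g x)) i x"
  using bounded_bilinear.has_vector_derivative[OF assms(1) assms(2,3)[unfolded has_pd_def]]
  by (simp add: has_pd_def)

lemmas has_pd_mult = has_pd_bilinear[OF bounded_bilinear_mult]
lemmas has_pd_inner = has_pd_bilinear[OF bounded_bilinear_inner]

lemma has_pd_linear:
  assumes "bounded_linear l" "has_pd f f' i x"
  shows "has_pd (\<lambda>x. l (f x)) (l f') i x"
  using bounded_linear.has_vector_derivative[OF assms(1) assms(2)[unfolded has_pd_def]]
  by (simp add: has_pd_def)

lemma has_pd_entry: "has_pd f f' i x \<Longrightarrow> has_pd (\<lambda>x. f x $ j) (f' $ j) i x"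
  using has_pd_linear[OF bounded_linear_vec_nth] .

lemma has_pd_compose:
  fixes f :: "real^'n::finite \<Rightarrow> real" and g :: "real \<Rightarrow> real"
  assumes "has_pd f f' i x" "(g has_real_derivative g') (at (f x))"
  shows "has_pd (\<lambda>x. g (f x)) (g' * f') i x"
proof -
  have "((\<lambda>s. g (f (x + s *\<^sub>R axis i 1))) has_real_derivative g' * f') (at 0)"
    using assms unfolding has_pd_def
    by (intro DERIV_chain2[where f=g]) (auto simp: has_real_derivative_iff_has_vector_derivative)
  then show ?thesis
    by (simp add: has_pd_def has_real_derivative_iff_has_vector_derivative)
qed

text \<open>Moves the derivative from parameter 0 to an arbitrary point of the coordinate line, as
  the mean value bound in \<open>integral_pd_zero\<close> requires.\<close>

lemma has_pd_shift:
  assumes "has_pd f f' i (x + s *\<^sub>R axis i 1)"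
  shows "((\<lambda>s. f (x + s *\<^sub>R axis i 1)) has_vector_derivative f') (at s)"
proof -
  have 1: "((\<lambda>r. r - s) has_vector_derivative 1) (at s)"
    by (auto intro!: derivative_eq_intros)
  have "((\<lambda>r. f ((x + s *\<^sub>R axis i 1) + (r - s) *\<^sub>R axis i 1)) has_vector_derivative f') (at s)"
    using vector_diff_chain_at[OF 1, of "\<lambda>s'. f ((x + s *\<^sub>R axis i 1) + s' *\<^sub>R axis i 1)" f']
      assms[unfolded has_pd_def]
    by (simp add: o_def)
  then show ?thesis
    by (simp add: algebra_simps)
qed

section \<open>Integrals of compactly supported functions and of their derivatives\<close>

lemma lborel_integral_translate:
  fixes f :: "'a::euclidean_space \<Rightarrow> real"
  assumes "f \<in> borel_measurable lborel"
  shows "(\<integral>x. f (x + c) \<partial>lborel) = (\<integral>x. f x \<partial>lborel)"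
    "integrable lborel (\<lambda>x. f (x + c)) \<longleftrightarrow> integrable lborel f"
proof -
  have "(\<integral>x. f x \<partial>lborel) = (\<integral>x. f x \<partial>distr lborel borel ((+) c))"
    by (simp add: lborel_distr_plus)
  also have "\<dots> = (\<integral>x. f (x + c) \<partial>lborel)"
    using assms by (subst integral_distr) (auto simp: add.commute)
  finally show "(\<integral>x. f (x + c) \<partial>lborel) = (\<integral>x. f x \<partial>lborel)" by simp
  have "integrable lborel f \<longleftrightarrow> integrable (distr lborel borel ((+) c)) f"
    by (simp add: lborel_distr_plus)
  also have "\<dots> \<longleftrightarrow> integrable lborel (\<lambda>x. f (x + c))"
    using assms by (subst integrable_distr_eq) (auto simp: add.commute)
  finally show "integrable lborel (\<lambda>x. f (x + c)) \<longleftrightarrow> integrable lborel f" by simp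
qed

lemma continuous_compact_support:
  fixes f :: "'a::euclidean_space \<Rightarrow> real"
  assumes "continuous_on UNIV f" "\<And>x. x \<notin> cbox a b \<Longrightarrow> f x = 0"
  shows "integrable lborel f" "(\<integral>x. f x \<partial>lborel) = integral (cbox a b) f"
    "f integrable_on cbox a b" "bounded (range f)"
proof -
  have e: "f = (\<lambda>x. indicator (cbox a b) x *\<^sub>R f x)"
    using assms(2) by (intro ext) (auto simp: indicator_def of_bool_def)
  have if_e: "(\<lambda>x. if x \<in> cbox a b then f x else 0) = f"
    using assms(2) by auto
  have "integrable lborel (\<lambda>x. indicator (cbox a b) x *\<^sub>R f x)"
    by (intro borel_integrable_compact) (auto intro: continuous_on_subset[OF assms(1)])
  then show i: "integrable lborel f" using e by simp
  then have "(f has_integral (\<integral>x. f x \<partial>lborel)) UNIV"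
    by (rule has_integral_integral_lborel)
  then have "(f has_integral (\<integral>x. f x \<partial>lborel)) (cbox a b)"
    using has_integral_restrict_UNIV[of "cbox a b" f] if_e by simp
  then show "(\<integral>x. f x \<partial>lborel) = integral (cbox a b) f" "f integrable_on cbox a b"
    by (auto simp: integral_unique)
  have "compact (f ` cbox a b)"
    by (intro compact_continuous_image) (auto intro: continuous_on_subset[OF assms(1)])
  then have "bounded (insert 0 (f ` cbox a b))"
    using compact_imp_bounded by auto
  then show "bounded (range f)"
    by (rule bounded_subset) (use assms(2) in auto)
qed

text \<open>By translation invariance every difference quotient of \<open>V\<close> in direction
  \<open>i\<close> has integral zero; dominated convergence carries this over to the
  derivative.\<close>

lemma integral_pd_zero:
  fixes V V' :: "real^'n::finite \<Rightarrow> real"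
  assumes c: "continuous_on UNIV V" "continuous_on UNIV V'"
    and d: "\<And>x. has_pd V (V' x) i x"
    and z: "\<And>x. norm x \<ge> R \<Longrightarrow> V x = 0" "\<And>x. norm x \<ge> R \<Longrightarrow> V' x = 0"
  shows "(\<integral>x. V' x \<partial>lborel) = 0"
proof -
  define e :: "real^'n" where "e = axis i 1"
  have [simp]: "norm e = 1" by (simp add: e_def)
  \<comment> \<open>The extra 1 keeps \<open>x + s *\<^sub>R e\<close> with
    \<open>\<bar>s\<bar> \<le> 1\<close> outside the ball of radius \<open>R\<close> whenever
    \<open>x\<close> lies outside the box.\<close>
  define r where "r = \<bar>R\<bar> + 1"
  obtain a b where ab: "cball (0::real^'n) r \<subseteq> cbox a b"
    using bounded_cball bounded_subset_cbox_symmetric by blast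
  have out: "V x = 0" "V' x = 0" "V (x + s *\<^sub>R e) = 0" if "x \<notin> cbox a b" "\<bar>s\<bar> \<le> 1" for x s
  proof -
    have n: "norm x > r" using ab that(1) by (force simp: subset_eq not_le[symmetric])
    then show "V x = 0" "V' x = 0" by (auto intro!: z simp: r_def)
    have "norm x \<le> norm (x + s *\<^sub>R e) + norm (s *\<^sub>R e)"
      by (metis add_diff_cancel norm_triangle_sub add.commute norm_minus_commute norm_triangle_ineq4)
    then show "V (x + s *\<^sub>R e) = 0" using n that(2) by (auto intro!: z simp: r_def)
  qed
  have iV: "integrable lborel V"
    using continuous_compact_support(1)[OF c(1)] out by (metis abs_zero zero_le_one)
  have "bounded (range V')"
    using continuous_compact_support(4)[OF c(2)] out by (metis abs_zero zero_le_one)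
  then obtain B where B: "\<And>x. \<bar>V' x\<bar> \<le> B" by (auto simp: bounded_iff)
  define w where "w k x = (V (x + (1 / Suc k) *\<^sub>R e) - V x) * Suc k" for k x
  have w0: "(\<integral>x. w k x \<partial>lborel) = 0" for k
    using lborel_integral_translate[of V] iV by (simp add: w_def)
  have mv: "((\<lambda>s. V (x + s *\<^sub>R e)) has_vector_derivative V' (x + s *\<^sub>R e)) (at s)" for x s
    unfolding e_def using d by (intro has_pd_shift)
  have "(\<lambda>k. \<integral>x. w k x \<partial>lborel) \<longlonglongrightarrow> (\<integral>x. V' x \<partial>lborel)"
  proof (rule integral_dominated_convergence[where w="\<lambda>x. indicator (cbox a b) x *\<^sub>R B"])
    show "V' \<in> borel_measurable lborel" "w i \<in> borel_measurable lborel" for i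
      using c iV unfolding w_def
      by (auto intro!: borel_measurable_continuous_onI continuous_intros continuous_on_compose2[OF c(1)])
    show "integrable lborel (\<lambda>x::real^'n. indicator (cbox a b) x *\<^sub>R B)"
      by (intro borel_integrable_compact) auto
    show "AE x in lborel. norm (w k x) \<le> indicator (cbox a b) x *\<^sub>R B" for k
    proof (intro AE_I2)
      fix x
      show "norm (w k x) \<le> indicator (cbox a b) x *\<^sub>R B"
      proof (cases "x \<in> cbox a b")
        case False
        then show ?thesis using out[of x "1 / Suc k"] by (simp add: w_def)
      next
        case True
        have "norm (V (x + (1 / Suc k) *\<^sub>R e) - V (x + 0 *\<^sub>R e)) \<le> B * norm (1 / Suc k - 0)"
          by (rule field_differentiable_bound[of UNIV "\<lambda>s. V (x + s *\<^sub>R e)" "\<lambda>s. V' (x + s *\<^sub>R e)" B])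
            (use B mv[of x] in \<open>auto simp: has_real_derivative_iff_has_vector_derivative\<close>)
        then have "\<bar>V (x + (1 / Suc k) *\<^sub>R e) - V x\<bar> * Suc k \<le> B * \<bar>1 / Suc k\<bar> * Suc k"
          by (intro mult_right_mono) auto
        then show ?thesis using True
          by (simp add: w_def abs_mult del: of_nat_Suc)
      qed
    qed
    show "AE x in lborel. (\<lambda>k. w k x) \<longlonglongrightarrow> V' x"
    proof (intro AE_I2)
      fix x
      have "((\<lambda>s. (V (x + s *\<^sub>R e) - V x) / s) \<longlongrightarrow> V' x) (at 0)"
        using d[of x] by (simp add: has_pd_def e_def has_real_derivative_iff_has_vector_derivative[symmetric] DERIV_def)
      moreover have "filterlim (\<lambda>k. 1 / Suc k) (at (0::real)) sequentially"
        using LIMSEQ_inverse_real_of_nat by (auto simp: filterlim_at divide_inverse intro!: always_eventually)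
      ultimately have "(\<lambda>k. (V (x + (1 / Suc k) *\<^sub>R e) - V x) / (1 / Suc k)) \<longlonglongrightarrow> V' x"
        by (rule filterlim_compose)
      then show "(\<lambda>k. w k x) \<longlonglongrightarrow> V' x" by (simp add: w_def)
    qed
  qed
  then show ?thesis using w0 by (simp add: LIMSEQ_const_iff)
qed

section \<open>The pointwise estimate\<close>

text \<open>Cauchy-Schwarz against the constant 1, once for each index. Each use costs the square
  root of the dimension, hence the factor \<open>CARD('n)\<close>.\<close>

lemma abs_double_sum_le:
  fixes m :: "'n::finite \<Rightarrow> 'n \<Rightarrow> real"
  assumes "\<And>a b. \<bar>m a b\<bar> \<le> c * (\<alpha> a * \<beta> b)" "c \<ge> 0" "\<And>a. \<alpha> a \<ge> 0" "\<And>b. \<beta> b \<ge> 0"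
  shows "\<bar>\<Sum>a\<in>UNIV. \<Sum>b\<in>UNIV. m a b\<bar>
    \<le> c * CARD('n) * (sqrt (\<Sum>a\<in>UNIV. (\<alpha> a)\<^sup>2) * sqrt (\<Sum>b\<in>UNIV. (\<beta> b)\<^sup>2))"
proof -
  have s: "(\<Sum>a\<in>UNIV. f a) \<le> sqrt CARD('n) * sqrt (\<Sum>a\<in>UNIV. (f a)\<^sup>2)" if "\<And>a. f a \<ge> 0" for f :: "'n \<Rightarrow> real"
    using L2_set_mult_ineq[of f "\<lambda>_. 1" UNIV] that by (simp add: L2_set_def mult.commute)
  have "\<bar>\<Sum>a\<in>UNIV. \<Sum>b\<in>UNIV. m a b\<bar> \<le> (\<Sum>a\<in>UNIV. \<Sum>b\<in>UNIV. c * (\<alpha> a * \<beta> b))"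
    by (intro order.trans[OF sum_abs] sum_mono) (use assms(1) in auto)
  also have "\<dots> = c * ((\<Sum>a\<in>UNIV. \<alpha> a) * (\<Sum>b\<in>UNIV. \<beta> b))"
    unfolding sum_product by (simp add: sum_distrib_left)
  also have "\<dots> \<le> c * ((sqrt CARD('n) * sqrt (\<Sum>a\<in>UNIV. (\<alpha> a)\<^sup>2)) * (sqrt CARD('n) * sqrt (\<Sum>b\<in>UNIV. (\<beta> b)\<^sup>2)))"
    using assms by (intro mult_left_mono mult_mono s sum_nonneg mult_nonneg_nonneg) (auto intro!: sum_nonneg)
  also have "\<dots> = c * CARD('n) * (sqrt (\<Sum>a\<in>UNIV. (\<alpha> a)\<^sup>2) * sqrt (\<Sum>b\<in>UNIV. (\<beta> b)\<^sup>2))"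
    by (simp add: algebra_simps)
  finally show ?thesis .
qed

lemma abs_entry_le_norm: "\<bar>(A::real^'n::finite^'m::finite) $ i $ j\<bar> \<le> norm A"
  using Finite_Cartesian_Product.norm_nth_le[of A i] component_le_norm_cart[of "A $ i" j] by simp

lemma norm_le_sum_entries: "norm (A::real^'n::finite^'m::finite) \<le> (\<Sum>i\<in>UNIV. \<Sum>j\<in>UNIV. \<bar>A $ i $ j\<bar>)"
proof -
  have "norm A \<le> (\<Sum>i\<in>UNIV. norm (A $ i))"
    unfolding norm_vec_def by (rule L2_set_le_sum) auto
  also have "\<dots> \<le> (\<Sum>i\<in>UNIV. \<Sum>j\<in>UNIV. \<bar>A $ i $ j\<bar>)"
    by (intro sum_mono norm_le_l1_cart)
  finally show ?thesis .
qed

lemma bounded_bilinear_matrix_mult: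
  "bounded_bilinear ((**) :: real^'n::finite^'m::finite \<Rightarrow> real^'p::finite^'n \<Rightarrow> real^'p^'m)"
proof -
  have "bilinear ((**) :: real^'n::finite^'m::finite \<Rightarrow> real^'p::finite^'n \<Rightarrow> real^'p^'m)"
    unfolding bilinear_def linear_iff
    by (auto simp: matrix_matrix_mult_def vec_eq_iff algebra_simps sum.distrib sum_distrib_left)
  then show ?thesis by (simp add: bilinear_conv_bounded_bilinear)
qed

text \<open>With \<open>X = h\<close>, \<open>A = (\<delta> + h)\<^sup>-\<^sup>1\<close>, \<open>G1 = G' v\<close>, \<open>G2 = G'' v\<close>, the left-hand side is
  \<open>\<phi> \<partial>\<^sub>t F - \<nabla>\<^sub>a W\<^sup>a\<close> for the field \<open>W\<^sup>a = \<phi> A\<^sup>a\<^sup>b \<nabla>\<^sub>b F - F \<nabla>\<^sub>a \<phi>\<close>.\<close>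

lemma pointwise_divergence_bound:
  fixes A X N :: "real^'n::finite^'n" and dA X1 :: "'n \<Rightarrow> real^'n^'n" and X2 :: "'n \<Rightarrow> 'n \<Rightarrow> real^'n^'n"
    and \<phi>1 \<phi>2 :: "'n \<Rightarrow> real" and C :: real
  defines "r \<equiv> norm X" and "S \<equiv> \<Sum>a\<in>UNIV. (norm (X1 a))\<^sup>2" and "\<xi> \<equiv> \<lambda>a. inner X (X1 a)"
    and "C3 \<equiv> 9 * C * CARD('n)"
  assumes C: "C \<ge> 0" and A: "norm (A - mat 1) \<le> C * r" and dA: "\<And>a. norm (dA a) \<le> C * norm (X1 a)"
    and N: "norm N \<le> C * S" and \<phi>: "\<phi> \<ge> 0" "\<omega> \<ge> 0" "(\<Sum>a\<in>UNIV. (\<phi>1 a)\<^sup>2) \<le> \<phi> * \<omega>"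
    and \<phi>2: "\<bar>\<Sum>a\<in>UNIV. \<phi>2 a\<bar> \<le> \<omega>" and F: "F \<ge> 0" and G1: "G1 \<ge> 0"
    and small: "C3 * r \<le> 1"
    and G2: "4 * r\<^sup>2 * max 0 (- G2) \<le> 2 * G1 - C3 * G1 * r"
  shows "\<phi> * (2 * G1 * inner X ((\<Sum>a\<in>UNIV. \<Sum>b\<in>UNIV. A $ a $ b *\<^sub>R X2 a b) + N))
     - (\<Sum>a\<in>UNIV. \<phi>1 a * (\<Sum>b\<in>UNIV. A $ a $ b * (2 * G1 * \<xi> b))
          + \<phi> * (\<Sum>b\<in>UNIV. dA a $ a $ b * (2 * G1 * \<xi> b)
               + A $ a $ b * (4 * G2 * \<xi> a * \<xi> b + 2 * G1 * (inner (X1 a) (X1 b) + inner X (X2 a b))))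
          - (2 * G1 * \<xi> a) * \<phi>1 a - F * \<phi>2 a)
    \<le> \<omega> * (F + C3 * G1 * r^3)"
proof -
  define B where "B = A - mat 1"
  define n where "n = real CARD('n)"
  have n1: "n \<ge> 1" unfolding n_def by (simp add: Suc_leI)
  have A_eq: "A $ a $ b = (if a = b then 1 else 0) + B $ a $ b" for a b
    by (simp add: B_def mat_def)
  have r0: "r \<ge> 0" and S0: "S \<ge> 0" by (auto simp: r_def S_def sum_nonneg)
  have Bab: "\<bar>B $ a $ b\<bar> \<le> C * r" for a b
    using abs_entry_le_norm[of B a b] A by (simp add: B_def)
  have \<xi>le: "\<bar>\<xi> a\<bar> \<le> r * norm (X1 a)" for a
    unfolding \<xi>_def r_def by (rule Cauchy_Schwarz_ineq2)
  define Z where "Z = (\<Sum>a\<in>UNIV. (\<xi> a)\<^sup>2)"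
  have Z0: "Z \<ge> 0" by (simp add: Z_def sum_nonneg)
  have ZS: "Z \<le> r\<^sup>2 * S"
    unfolding Z_def S_def sum_distrib_left
    by (intro sum_mono) (metis \<xi>le abs_ge_zero power2_abs power_mono power_mult_distrib)
  \<comment> \<open>\<open>E1\<close> to \<open>E4\<close> are the deviations from the Euclidean
    case. \<open>E1\<close>, \<open>E2\<close> and \<open>E4\<close> come from
    \<open>A - mat 1\<close>, \<open>E3\<close> from the derivative of \<open>A\<close>; each
    carries at least one factor \<open>r\<close>.\<close>
  define E1 where "E1 = (\<Sum>a\<in>UNIV. \<Sum>b\<in>UNIV. B $ a $ b * (\<xi> a * \<xi> b))"
  define E2 where "E2 = (\<Sum>a\<in>UNIV. \<Sum>b\<in>UNIV. B $ a $ b * inner (X1 a) (X1 b))"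
  define E3 where "E3 = (\<Sum>a\<in>UNIV. \<Sum>b\<in>UNIV. dA a $ a $ b * \<xi> b)"
  define E4 where "E4 = (\<Sum>a\<in>UNIV. \<Sum>b\<in>UNIV. \<phi>1 a * (B $ a $ b * \<xi> b))"
  have sqS: "sqrt S * sqrt S = S" using S0 by simp
  have E1: "\<bar>E1\<bar> \<le> C * r * n * Z"
  proof -
    have "\<bar>E1\<bar> \<le> (C * r) * CARD('n) * (sqrt (\<Sum>a\<in>UNIV. \<bar>\<xi> a\<bar>\<^sup>2) * sqrt (\<Sum>b\<in>UNIV. \<bar>\<xi> b\<bar>\<^sup>2))"
      unfolding E1_def using C r0
      by (intro abs_double_sum_le) (auto simp: abs_mult intro!: mult_right_mono Bab)
    then show ?thesis using Z0 by (simp add: Z_def n_def)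
  qed
  have E2: "\<bar>E2\<bar> \<le> C * r * n * S"
  proof -
    have "\<bar>E2\<bar> \<le> (C * r) * CARD('n) * (sqrt (\<Sum>a\<in>UNIV. (norm (X1 a))\<^sup>2) * sqrt (\<Sum>b\<in>UNIV. (norm (X1 b))\<^sup>2))"
      unfolding E2_def using C r0
      by (intro abs_double_sum_le) (auto simp: abs_mult intro!: mult_mono Bab Cauchy_Schwarz_ineq2)
    then show ?thesis using S0 by (simp add: S_def n_def)
  qed
  have E3: "\<bar>E3\<bar> \<le> C * r * n * S"
  proof -
    have "\<bar>E3\<bar> \<le> (C * r) * CARD('n) * (sqrt (\<Sum>a\<in>UNIV. (norm (X1 a))\<^sup>2) * sqrt (\<Sum>b\<in>UNIV. (norm (X1 b))\<^sup>2))"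
      unfolding E3_def
    proof (intro abs_double_sum_le)
      fix a b
      have "\<bar>dA a $ a $ b * \<xi> b\<bar> \<le> (C * norm (X1 a)) * (r * norm (X1 b))"
        unfolding abs_mult using C
        by (intro mult_mono \<xi>le order.trans[OF abs_entry_le_norm dA]) auto
      then show "\<bar>dA a $ a $ b * \<xi> b\<bar> \<le> C * r * (norm (X1 a) * norm (X1 b))"
        by (simp add: mult_ac)
    qed (use C r0 in auto)
    then show ?thesis using S0 by (simp add: S_def n_def)
  qed
  have E4: "2 * \<bar>E4\<bar> \<le> C * n * (\<phi> * r * S + r^3 * \<omega>)"
  proof -
    have "\<bar>E4\<bar> \<le> (C * r\<^sup>2) * CARD('n) * (sqrt (\<Sum>a\<in>UNIV. \<bar>\<phi>1 a\<bar>\<^sup>2) * sqrt (\<Sum>b\<in>UNIV. (norm (X1 b))\<^sup>2))"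
      unfolding E4_def
    proof (intro abs_double_sum_le)
      fix a b
      have "\<bar>\<phi>1 a * (B $ a $ b * \<xi> b)\<bar> \<le> \<bar>\<phi>1 a\<bar> * ((C * r) * (r * norm (X1 b)))"
        unfolding abs_mult using C r0
        by (intro mult_mono Bab \<xi>le) auto
      then show "\<bar>\<phi>1 a * (B $ a $ b * \<xi> b)\<bar> \<le> C * r\<^sup>2 * (\<bar>\<phi>1 a\<bar> * norm (X1 b))"
        by (simp add: mult_ac power2_eq_square)
    qed (use C r0 in auto)
    also have "\<dots> \<le> (C * r\<^sup>2) * n * (sqrt (\<phi> * \<omega>) * sqrt S)"
      unfolding n_def S_def using C r0 \<phi> by (intro mult_left_mono mult_mono) (auto simp: sum_nonneg)
    finally have 1: "\<bar>E4\<bar> \<le> C * n * (r\<^sup>2 * (sqrt (\<phi> * \<omega>) * sqrt S))"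
      by (simp add: mult_ac)
    \<comment> \<open>Young's inequality is applied to these two factors. The first,
      \<open>\<phi> * r * S\<close>, can be absorbed by the good gradient term; the second,
      \<open>r^3 * \<omega>\<close>, is free of gradients of h and stays on the right-hand
      side.\<close>
    have e: "sqrt (\<phi> * r * S) * sqrt (r^3 * \<omega>) = r\<^sup>2 * (sqrt (\<phi> * \<omega>) * sqrt S)"
    proof -
      have "(\<phi> * r * S) * (r^3 * \<omega>) = (r\<^sup>2)\<^sup>2 * ((\<phi> * \<omega>) * S)"
        by (simp add: power2_eq_square power3_eq_cube mult_ac)
      then have "sqrt (\<phi> * r * S) * sqrt (r^3 * \<omega>) = sqrt ((r\<^sup>2)\<^sup>2 * ((\<phi> * \<omega>) * S))"
        by (metis real_sqrt_mult)
      also have "\<dots> = r\<^sup>2 * (sqrt (\<phi> * \<omega>) * sqrt S)"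
        by (simp only: real_sqrt_mult[of "(r\<^sup>2)\<^sup>2"] real_sqrt_mult[of "\<phi> * \<omega>" S] real_sqrt_abs abs_power2)
      finally show ?thesis .
    qed
    have "0 \<le> (sqrt (\<phi> * r * S) - sqrt (r^3 * \<omega>))\<^sup>2" by simp
    then have "2 * (r\<^sup>2 * (sqrt (\<phi> * \<omega>) * sqrt S)) \<le> \<phi> * r * S + r^3 * \<omega>"
      using \<phi> r0 S0 e by (simp add: power2_diff)
    then have "C * n * (2 * (r\<^sup>2 * (sqrt (\<phi> * \<omega>) * sqrt S))) \<le> C * n * (\<phi> * r * S + r^3 * \<omega>)"
      using C n1 by (intro mult_left_mono) auto
    with 1 show ?thesis by simp
  qed
  have E5: "inner X N \<le> C * r * n * S"
  proof -
    have "inner X N \<le> r * (C * S)"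
      using Cauchy_Schwarz_ineq2[of X N] mult_left_mono[OF N r0] by (simp add: r_def)
    also have "\<dots> \<le> (C * r * S) * n"
      using n1 mult_left_mono[of 1 n "C * r * S"] C r0 S0 by (simp add: mult_ac)
    finally show ?thesis by (simp add: mult_ac)
  qed
  \<comment> \<open>\<open>H\<close> collects the second derivatives of h. It occurs with the same
    coefficient \<open>2 * \<phi> * G1\<close> in the time derivative and in the divergence, so it
    drops out.\<close>
  define H where "H = (\<Sum>a\<in>UNIV. \<Sum>b\<in>UNIV. A $ a $ b * inner X (X2 a b))"
  have delta: "(\<Sum>a\<in>UNIV. \<Sum>b\<in>UNIV. A $ a $ b * f a b) = (\<Sum>a\<in>UNIV. f a a) + (\<Sum>a\<in>UNIV. \<Sum>b\<in>UNIV. B $ a $ b * f a b)"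
    for f :: "'n \<Rightarrow> 'n \<Rightarrow> real"
    by (simp add: A_eq distrib_right sum.distrib if_distrib[of "\<lambda>z. z * _"] sum.delta cong: if_cong)
  have i1: "inner X ((\<Sum>a\<in>UNIV. \<Sum>b\<in>UNIV. A $ a $ b *\<^sub>R X2 a b) + N) = H + inner X N"
    by (simp add: H_def inner_add_right inner_sum_right)
  have i2: "(\<Sum>a\<in>UNIV. \<phi>1 a * (\<Sum>b\<in>UNIV. A $ a $ b * (2 * G1 * \<xi> b)))
    = 2 * G1 * ((\<Sum>a\<in>UNIV. \<phi>1 a * \<xi> a) + E4)"
  proof -
    have "(\<Sum>a\<in>UNIV. \<phi>1 a * (\<Sum>b\<in>UNIV. A $ a $ b * (2 * G1 * \<xi> b)))
       = 2 * G1 * (\<Sum>a\<in>UNIV. \<Sum>b\<in>UNIV. A $ a $ b * (\<phi>1 a * \<xi> b))"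
      by (simp add: sum_distrib_left mult_ac)
    then show ?thesis unfolding delta E4_def by (simp add: mult_ac)
  qed
  have i3: "(\<Sum>a\<in>UNIV. (\<Sum>b\<in>UNIV. dA a $ a $ b * (2 * G1 * \<xi> b)
               + A $ a $ b * (4 * G2 * \<xi> a * \<xi> b + 2 * G1 * (inner (X1 a) (X1 b) + inner X (X2 a b)))))
     = 2 * G1 * E3 + 4 * G2 * (Z + E1) + 2 * G1 * (S + E2 + H)"
  proof -
    have "(\<Sum>a\<in>UNIV. (\<Sum>b\<in>UNIV. dA a $ a $ b * (2 * G1 * \<xi> b)
               + A $ a $ b * (4 * G2 * \<xi> a * \<xi> b + 2 * G1 * (inner (X1 a) (X1 b) + inner X (X2 a b)))))
     = 2 * G1 * E3 + 4 * G2 * (\<Sum>a\<in>UNIV. \<Sum>b\<in>UNIV. A $ a $ b * (\<xi> a * \<xi> b))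
      + 2 * G1 * ((\<Sum>a\<in>UNIV. \<Sum>b\<in>UNIV. A $ a $ b * inner (X1 a) (X1 b)) + H)"
      by (simp add: E3_def H_def sum_distrib_left sum.distrib algebra_simps)
    then show ?thesis unfolding delta
      by (simp add: Z_def S_def E1_def E2_def power2_eq_square dot_square_norm)
  qed
  have split: "(\<Sum>a\<in>UNIV. p a + \<phi> * q a - (2 * G1 * \<xi> a) * \<phi>1 a - F * \<phi>2 a)
    = (\<Sum>a\<in>UNIV. p a) + \<phi> * (\<Sum>a\<in>UNIV. q a) - 2 * G1 * (\<Sum>a\<in>UNIV. \<phi>1 a * \<xi> a) - F * (\<Sum>a\<in>UNIV. \<phi>2 a)"
    for p q :: "'n \<Rightarrow> real"
    by (simp add: sum.distrib sum_subtractf sum_distrib_left mult_ac)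
  \<comment> \<open>Besides \<open>H\<close> the terms \<open>\<phi>1 a * \<xi> a\<close> cancel:
    the Euclidean part of the field is \<open>\<phi> \<nabla>F - F \<nabla>\<phi>\<close>, with
    divergence \<open>\<phi> \<Delta>F - F \<Delta>\<phi>\<close>. Only the part with
    \<open>A - mat 1\<close> still pairs the gradient of the weight with that of h.\<close>
  have "\<phi> * (2 * G1 * inner X ((\<Sum>a\<in>UNIV. \<Sum>b\<in>UNIV. A $ a $ b *\<^sub>R X2 a b) + N))
     - (\<Sum>a\<in>UNIV. \<phi>1 a * (\<Sum>b\<in>UNIV. A $ a $ b * (2 * G1 * \<xi> b))
          + \<phi> * (\<Sum>b\<in>UNIV. dA a $ a $ b * (2 * G1 * \<xi> b)
               + A $ a $ b * (4 * G2 * \<xi> a * \<xi> b + 2 * G1 * (inner (X1 a) (X1 b) + inner X (X2 a b))))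
          - (2 * G1 * \<xi> a) * \<phi>1 a - F * \<phi>2 a)
    = \<phi> * (2 * G1 * (H + inner X N)) - 2 * G1 * ((\<Sum>a\<in>UNIV. \<phi>1 a * \<xi> a) + E4)
      - \<phi> * (2 * G1 * E3 + 4 * G2 * (Z + E1) + 2 * G1 * (S + E2 + H))
      + 2 * G1 * (\<Sum>a\<in>UNIV. \<phi>1 a * \<xi> a) + F * (\<Sum>a\<in>UNIV. \<phi>2 a)"
    unfolding i1 split i2 i3 by simp
  also have "\<dots> = \<phi> * (2 * G1 * inner X N - 2 * G1 * E3 - 4 * G2 * (Z + E1) - 2 * G1 * S - 2 * G1 * E2)
      - 2 * G1 * E4 + F * (\<Sum>a\<in>UNIV. \<phi>2 a)" (is "_ = \<phi> * ?T - _ + _")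
    by (simp add: algebra_simps)
  also have "\<dots> \<le> \<phi> * (- (C * n * G1 * r * S)) + G1 * (C * n * (\<phi> * r * S + r^3 * \<omega>)) + F * \<omega>"
  proof -
    \<comment> \<open>The 9 in \<open>C3\<close>: the assumption on \<open>G2\<close> provides
      \<open>- 9 * P * G1 * S\<close>. The factor \<open>1 + P\<close> in the bound of
      \<open>Z + E1\<close> costs 2 of the 9, and N, \<open>E2\<close>, \<open>E3\<close> cost 2
      each. The last one absorbs the gradient part of \<open>E4\<close>.\<close>
    define P where "P = C * r * n"
    have P0: "P \<ge> 0" using C r0 n1 by (simp add: P_def)
    have P1: "9 * P \<le> 1" using small by (simp add: P_def C3_def n_def mult_ac)
    \<comment> \<open>\<open>Z + E1\<close> turns out to be nonnegative, so only the negative part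
      of \<open>G2\<close> can do harm.\<close>
    define g where "g = max 0 (- G2)"
    have g0: "g \<ge> 0" and gG: "- G2 \<le> g" by (auto simp: g_def)
    have cond: "4 * (r\<^sup>2 * g) \<le> 2 * G1 - 9 * P * G1"
      using G2 by (simp add: g_def P_def C3_def n_def mult_ac)
    have ZE: "0 \<le> Z + E1" "Z + E1 \<le> (1 + P) * (r\<^sup>2 * S)"
    proof -
      have a: "\<bar>E1\<bar> \<le> P * Z" using E1 by (simp add: P_def)
      moreover have "P * Z \<le> 1 * Z" using P1 P0 Z0 by (intro mult_right_mono) auto
      ultimately show "0 \<le> Z + E1" by linarith
      have "Z + E1 \<le> (1 + P) * Z" using a by (simp add: algebra_simps)
      also have "\<dots> \<le> (1 + P) * (r\<^sup>2 * S)" using ZS P0 by (intro mult_left_mono) auto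
      finally show "Z + E1 \<le> (1 + P) * (r\<^sup>2 * S)" .
    qed
    have "- G2 * (Z + E1) \<le> g * (Z + E1)" using gG ZE by (intro mult_right_mono) auto
    also have "\<dots> \<le> g * ((1 + P) * (r\<^sup>2 * S))" using g0 ZE by (intro mult_left_mono) auto
    also have "4 * \<dots> = (1 + P) * (4 * (r\<^sup>2 * g)) * S" by (simp add: mult_ac)
    also have "\<dots> \<le> (2 * G1 - 9 * P * G1 + P * (2 * G1)) * S"
    proof (intro mult_right_mono S0)
      have "P * (4 * (r\<^sup>2 * g)) \<le> P * (2 * G1)"
        using mult_nonneg_nonneg[OF P0 G1] cond P0 by (intro mult_left_mono) (auto simp: mult_ac)
      then show "(1 + P) * (4 * (r\<^sup>2 * g)) \<le> 2 * G1 - 9 * P * G1 + P * (2 * G1)"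
        using cond by (simp add: algebra_simps)
    qed
    finally have t2: "- 4 * G2 * (Z + E1) \<le> (2 * G1 - 7 * P * G1) * S" by (simp add: algebra_simps)
    have t1: "2 * G1 * inner X N \<le> 2 * G1 * (P * S)"
      using E5 G1 by (intro mult_left_mono) (auto simp: P_def)
    have t3: "- (2 * G1 * E3) \<le> 2 * G1 * (P * S)"
      using mult_left_mono[of "- E3" "P * S" "2 * G1"] E3 G1 by (auto simp: P_def)
    have t4: "- (2 * G1 * E2) \<le> 2 * G1 * (P * S)"
      using mult_left_mono[of "- E2" "P * S" "2 * G1"] E2 G1 by (auto simp: P_def)
    have "?T \<le> - (P * G1 * S)"
      using t1 t2 t3 t4 by (simp add: algebra_simps)
    then have 1: "\<phi> * ?T \<le> \<phi> * (- (C * n * G1 * r * S))"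
      using \<phi> by (intro mult_left_mono) (auto simp: P_def mult_ac)
    have 2: "- (2 * G1 * E4) \<le> G1 * (C * n * (\<phi> * r * S + r^3 * \<omega>))"
    proof -
      have "- (2 * E4) \<le> C * n * (\<phi> * r * S + r^3 * \<omega>)" using E4 by linarith
      from mult_left_mono[OF this G1] show ?thesis by (simp add: mult_ac)
    qed
    have 3: "F * (\<Sum>a\<in>UNIV. \<phi>2 a) \<le> F * \<omega>"
      using \<phi>2 F by (intro mult_left_mono) auto
    show ?thesis using 1 2 3 by linarith
  qed
  also have "\<dots> = \<omega> * (F + C * n * (G1 * r^3))" by (simp add: algebra_simps)
  also have "\<dots> \<le> \<omega> * (F + C3 * G1 * r^3)"
    using \<phi> C G1 r0 n1 by (intro mult_left_mono add_left_mono) (auto simp: C3_def n_def mult_ac intro!: mult_right_mono)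
  finally show ?thesis .
qed

section \<open>Inverse matrices near the identity\<close>

text \<open>The resolvent identity \<open>matrix_inv_diff\<close> is exact for difference quotients,
  so derivatives of matrix-valued curves are brought into that form.\<close>

lemma has_vector_derivative_iff_quotient:
  "(f has_vector_derivative D) (at x) \<longleftrightarrow> ((\<lambda>y. (1 / (y - x)) *\<^sub>R (f y - f x)) \<longlongrightarrow> D) (at x)"
proof -
  have e: "norm ((f y - f x) - (y - x) *\<^sub>R D) / norm (y - x) = norm ((1 / (y - x)) *\<^sub>R (f y - f x) - D)"
    if "y \<noteq> x" for y
  proof -
    have "(f y - f x) - (y - x) *\<^sub>R D = (y - x) *\<^sub>R ((1 / (y - x)) *\<^sub>R (f y - f x) - D)"
      using that by (simp add: scaleR_diff_right)
    then show ?thesis using that by simp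
  qed
  have "(f has_vector_derivative D) (at x) \<longleftrightarrow>
    ((\<lambda>y. norm ((f y - f x) - (y - x) *\<^sub>R D) / norm (y - x)) \<longlongrightarrow> 0) (at x)"
    unfolding has_vector_derivative_def has_derivative_iff_norm
    by (simp add: bounded_linear_scaleR_left)
  also have "\<dots> \<longleftrightarrow> ((\<lambda>y. norm ((1 / (y - x)) *\<^sub>R (f y - f x) - D)) \<longlongrightarrow> 0) (at x)"
    by (intro tendsto_cong) (unfold eventually_at_filter, use e in \<open>intro always_eventually allI impI\<close>)
  also have "\<dots> \<longleftrightarrow> ((\<lambda>y. (1 / (y - x)) *\<^sub>R (f y - f x)) \<longlongrightarrow> D) (at x)"
    by (simp add: tendsto_norm_zero_iff LIM_zero_iff)
  finally show ?thesis .
qed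

text \<open>If (1 + X) x = 0, then |x| = |X x| is at most |x| / 2, so the kernel is trivial and an
  inverse A exists. Both norm bounds follow from A - 1 = - A X, whose norm is at most half of |A|
  and can be absorbed.\<close>

lemma matrix_inv_perturb:
  "\<exists>C\<ge>1. \<forall>X::real^'n::finite^'n. C * norm X \<le> 1 \<longrightarrow>
     matrix_inv (mat 1 + X) ** (mat 1 + X) = mat 1 \<and> (mat 1 + X) ** matrix_inv (mat 1 + X) = mat 1 \<and>
     norm (matrix_inv (mat 1 + X)) \<le> C \<and> norm (matrix_inv (mat 1 + X) - mat 1) \<le> C * norm X"
proof -
  obtain K where K: "K > 0" "\<And>(A :: real^'n^'n) (B :: real^'n^'n). norm (A ** B) \<le> norm A * norm B * K"
    using bounded_bilinear.pos_bounded[OF bounded_bilinear_matrix_mult] by blast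
  have "bilinear ((*v) :: real^'n^'n \<Rightarrow> real^'n \<Rightarrow> real^'n)"
    unfolding bilinear_def linear_iff
    by (auto simp: matrix_vector_mult_def vec_eq_iff algebra_simps sum.distrib sum_distrib_left)
  then have "bounded_bilinear ((*v) :: real^'n^'n \<Rightarrow> real^'n \<Rightarrow> real^'n)"
    by (simp add: bilinear_conv_bounded_bilinear)
  then obtain L where L: "L > 0" "\<And>(A :: real^'n^'n) x. norm (A *v x) \<le> norm A * norm x * L"
    using bounded_bilinear.pos_bounded by blast
  define I where "I = norm (mat 1 :: real^'n^'n)"
  have I0: "I \<ge> 0" by (simp add: I_def)
  \<comment> \<open>The summands with a single constant \<open>K\<close> or \<open>L\<close> make
    the absorbed products at most 1/2; those with \<open>I\<close> are the resulting bounds for the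
    inverse and for its distance from the identity.\<close>
  define C where "C = 1 + 2 * K + 2 * L + 2 * I + 2 * I * K"
  have C: "C \<ge> 1" "C \<ge> 2 * K" "C \<ge> 2 * L" "C \<ge> 2 * I" "C \<ge> 2 * I * K"
    using K(1) L(1) I0 by (auto simp: C_def add_nonneg_nonneg)
  have "matrix_inv (mat 1 + X) ** (mat 1 + X) = mat 1 \<and> (mat 1 + X) ** matrix_inv (mat 1 + X) = mat 1 \<and>
     norm (matrix_inv (mat 1 + X)) \<le> C \<and> norm (matrix_inv (mat 1 + X) - mat 1) \<le> C * norm X"
    if X: "C * norm X \<le> 1" for X :: "real^'n^'n"
  proof -
    have "2 * K * norm X \<le> 1" "2 * L * norm X \<le> 1"
      using X C mult_right_mono[of "2 * K" C "norm X"] mult_right_mono[of "2 * L" C "norm X"] by auto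
    note XK = this
    have "x = 0" if "(mat 1 + X) *v x = 0" for x
    proof -
      have "x = - (X *v x)"
        using that by (simp add: matrix_vector_mult_add_rdistrib eq_neg_iff_add_eq_0)
      then have "norm x \<le> norm X * norm x * L" by (metis L(2) norm_minus_cancel)
      moreover have "2 * L * norm X * norm x \<le> 1 * norm x" using XK by (intro mult_right_mono) auto
      then have "2 * (norm X * norm x * L) \<le> norm x" by (simp add: mult_ac)
      ultimately have "norm x \<le> 0" by linarith
      then show ?thesis by simp
    qed
    then have inv: "invertible (mat 1 + X)"
      by (simp add: invertible_left_inverse matrix_left_invertible_ker)
    define A where "A = matrix_inv (mat 1 + X)"
    have A: "A ** (mat 1 + X) = mat 1" "(mat 1 + X) ** A = mat 1"
      using someI_ex[OF inv[unfolded invertible_def]] unfolding A_def matrix_inv_def by auto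
    have e: "A - mat 1 = - (A ** X)"
      using A(1) by (simp add: matrix_add_ldistrib eq_neg_iff_add_eq_0 algebra_simps)
    have "norm A \<le> I + norm (A - mat 1)"
      using norm_triangle_sub[of A "mat 1"] by (simp add: I_def)
    also have "norm (A - mat 1) \<le> norm A * norm X * K" unfolding e using K(2) by simp
    finally have "2 * norm A \<le> 2 * I + norm A * (2 * K * norm X)" by (simp add: mult_ac)
    also have "\<dots> \<le> 2 * I + norm A * 1" using XK by (intro add_left_mono mult_left_mono) auto
    finally have nA: "norm A \<le> 2 * I" by simp
    have "norm (A - mat 1) \<le> norm A * (norm X * K)" unfolding e using K(2) by (simp add: mult_ac)
    also have "\<dots> \<le> 2 * I * (norm X * K)" using nA K(1) by (intro mult_right_mono) auto
    also have "\<dots> = (2 * I * K) * norm X" by simp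
    also have "\<dots> \<le> C * norm X" using C by (intro mult_right_mono) auto
    finally show ?thesis using A nA C unfolding A_def by auto
  qed
  then show ?thesis using C(1) by blast
qed

text \<open>The resolvent identity: expand the product on the right and cancel each matrix against
  its inverse.\<close>

lemma matrix_inv_diff:
  fixes P Q :: "real^'n::finite^'n"
  assumes "matrix_inv P ** P = mat 1" "Q ** matrix_inv Q = mat 1"
  shows "matrix_inv P - matrix_inv Q = - (matrix_inv P ** (P - Q) ** matrix_inv Q)"
proof -
  have "matrix_inv P ** (P - Q) ** matrix_inv Q = (matrix_inv P ** P) ** matrix_inv Q - matrix_inv P ** (Q ** matrix_inv Q)"
    by (simp add: bounded_bilinear.diff_left[OF bounded_bilinear_matrix_mult]
        bounded_bilinear.diff_right[OF bounded_bilinear_matrix_mult] matrix_mul_assoc)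
  then show ?thesis using assms by simp
qed

text \<open>With the uniform bound on the inverses the resolvent identity becomes a Lipschitz
  estimate.\<close>

lemma matrix_inv_continuous:
  fixes f :: "'a::metric_space \<Rightarrow> real^'n::finite^'n"
  assumes "(f \<longlongrightarrow> f x) (at x)"
    and inv: "\<And>y. matrix_inv (f y) ** f y = mat 1" "\<And>y. f y ** matrix_inv (f y) = mat 1"
    and bd: "\<And>y. norm (matrix_inv (f y)) \<le> C"
  shows "((\<lambda>y. matrix_inv (f y)) \<longlongrightarrow> matrix_inv (f x)) (at x)"
proof -
  obtain K where K: "K > 0" "\<And>(A :: real^'n^'n) (B :: real^'n^'n). norm (A ** B) \<le> norm A * norm B * K"
    using bounded_bilinear.pos_bounded[OF bounded_bilinear_matrix_mult] by blast
  have C0: "C \<ge> 0" using bd[of undefined] norm_ge_zero order.trans by blast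
  have le: "norm (matrix_inv (f y) - matrix_inv (f x)) \<le> norm (f y - f x) * (C * C * K * K)" for y
  proof -
    have "norm (matrix_inv (f y) - matrix_inv (f x)) \<le> norm (matrix_inv (f y) ** (f y - f x)) * norm (matrix_inv (f x)) * K"
      unfolding matrix_inv_diff[OF inv, of y x] norm_minus_cancel by (rule K(2))
    also have "\<dots> \<le> (C * norm (f y - f x) * K) * C * K"
      using K C0 bd by (intro mult_mono order.trans[OF K(2)]) auto
    finally show ?thesis by (simp add: mult_ac)
  qed
  have "((\<lambda>y. norm (f y - f x) * (C * C * K * K)) \<longlongrightarrow> 0) (at x)"
    using assms(1) by (auto intro!: tendsto_mult_left_zero simp: tendsto_norm_zero_iff LIM_zero_iff)
  then have "((\<lambda>y. matrix_inv (f y) - matrix_inv (f x)) \<longlongrightarrow> 0) (at x)"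
    by (rule Lim_null_comparison[rotated]) (auto intro!: always_eventually le)
  then show ?thesis by (simp add: LIM_zero_iff)
qed

lemma matrix_inv_has_vector_derivative:
  fixes f :: "real \<Rightarrow> real^'n::finite^'n"
  assumes d: "(f has_vector_derivative f') (at x)"
    and inv: "\<And>y. matrix_inv (f y) ** f y = mat 1" "\<And>y. f y ** matrix_inv (f y) = mat 1"
    and bd: "\<And>y. norm (matrix_inv (f y)) \<le> C"
  shows "((\<lambda>y. matrix_inv (f y)) has_vector_derivative - (matrix_inv (f x) ** f' ** matrix_inv (f x))) (at x)"
proof -
  note bb = bounded_bilinear_matrix_mult
  have "(f \<longlongrightarrow> f x) (at x)"
    using d has_vector_derivative_continuous isCont_def by blast
  then have c: "((\<lambda>y. matrix_inv (f y)) \<longlongrightarrow> matrix_inv (f x)) (at x)"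
    by (rule matrix_inv_continuous) (use inv bd in auto)
  have "((\<lambda>y. - (matrix_inv (f y) ** ((1 / (y - x)) *\<^sub>R (f y - f x)) ** matrix_inv (f x)))
     \<longlongrightarrow> - (matrix_inv (f x) ** f' ** matrix_inv (f x))) (at x)"
    using d unfolding has_vector_derivative_iff_quotient
    by (intro tendsto_minus bounded_bilinear.tendsto[OF bb] c tendsto_const)
  moreover have "(\<lambda>y. - (matrix_inv (f y) ** ((1 / (y - x)) *\<^sub>R (f y - f x)) ** matrix_inv (f x)))
    = (\<lambda>y. (1 / (y - x)) *\<^sub>R (matrix_inv (f y) - matrix_inv (f x)))"
    using inv by (intro ext, subst matrix_inv_diff)
      (auto simp: bounded_bilinear.scaleR_left[OF bb] bounded_bilinear.scaleR_right[OF bb])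
  ultimately show ?thesis unfolding has_vector_derivative_iff_quotient by simp
qed

section \<open>Nondivergence form of the equation\<close>

definition grad_sq :: "(real^'n::finite \<Rightarrow> real \<Rightarrow> real^'n^'n) \<Rightarrow> real^'n \<Rightarrow> real \<Rightarrow> real" where
  "grad_sq h x t = (\<Sum>a\<in>UNIV. (norm (pdx a (\<lambda>y. h y t) x))\<^sup>2)"

text \<open>What is left of \<open>Q0\<close> after its last term has cancelled against the product
  rule for the divergence of \<open>Q1\<close>.\<close>

definition quad :: "(real^'n::finite \<Rightarrow> real \<Rightarrow> real^'n^'n) \<Rightarrow> real^'n \<Rightarrow> real \<Rightarrow> real^'n^'n" where
  "quad h x t = (\<chi> i j. (1/2) * (\<Sum>a\<in>UNIV. \<Sum>b\<in>UNIV. \<Sum>p\<in>UNIV. \<Sum>q\<in>UNIV.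
        ginv h x t $ a $ b * ginv h x t $ p $ q *
        (Dh h i p a x t * Dh h j q b x t
         + 2 * Dh h a j p x t * Dh h q i b x t
         - 2 * Dh h a j p x t * Dh h b i q x t
         - 2 * Dh h j p a x t * Dh h b i q x t
         - 2 * Dh h i p a x t * Dh h b j q x t)))"

text \<open>\<open>C\<close> and \<open>K\<close> are described by properties of arbitrary matrices,
  so they can be chosen from the dimension alone, before the solution is given. The assumption
  \<open>small\<close> puts h into the ball where \<open>inv\<close> applies.\<close>

locale small_ricci_deturck =
  fixes h :: "real^'n::finite \<Rightarrow> real \<Rightarrow> real^'n^'n" and C K :: real
  assumes c21: "C21 h" and rd: "ricci_deturck h"
    and C1: "C \<ge> 1" and K1: "K \<ge> 1"
    and mult_le: "\<And>(A :: real^'n^'n) (B :: real^'n^'n). norm (A ** B) \<le> norm A * norm B * K"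
    and inv: "\<And>X::real^'n^'n. C * norm X \<le> 1 \<Longrightarrow>
     matrix_inv (mat 1 + X) ** (mat 1 + X) = mat 1 \<and> (mat 1 + X) ** matrix_inv (mat 1 + X) = mat 1 \<and>
     norm (matrix_inv (mat 1 + X)) \<le> C \<and> norm (matrix_inv (mat 1 + X) - mat 1) \<le> C * norm X"
    and small: "\<And>x t. t \<ge> 0 \<Longrightarrow> C * norm (h x t) \<le> 1"
begin

text \<open>One constant for all structural bounds. The first summand controls the derivative of the
  inverse metric and, since \<open>C\<close> and \<open>K\<close> are at least 1, also its distance
  from the identity; the second controls \<open>quad\<close>.\<close>

definition D :: real where "D = C * C * K * K + 5 * C\<^sup>2 * real CARD('n)^6"

definition dginv :: "'n \<Rightarrow> real^'n \<Rightarrow> real \<Rightarrow> real^'n^'n" where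
  "dginv a x t = - (ginv h x t ** pdx a (\<lambda>y. h y t) x ** ginv h x t)"

lemma has_pd_h: "t \<ge> 0 \<Longrightarrow> has_pd (\<lambda>y. h y t) (pdx i (\<lambda>y. h y t) x) i x"
  using c21 unfolding C21_def has_pd_def by blast

lemma has_pd_h2: "t \<ge> 0 \<Longrightarrow> has_pd (pdx j (\<lambda>y. h y t)) (pdx i (pdx j (\<lambda>y. h y t)) x) i x"
  using c21 unfolding C21_def has_pd_def by blast

lemma slice_continuous:
  assumes "continuous_on (UNIV \<times> {0..}) (\<lambda>(x, t). f x t)" "t \<ge> (0::real)"
  shows "continuous_on UNIV (\<lambda>x. f x t)"
proof -
  have "continuous_on UNIV (\<lambda>x. (x, t))" by (intro continuous_intros)
  then show ?thesis
    using continuous_on_compose2[OF assms(1), of UNIV "\<lambda>x. (x, t)"] assms(2) by auto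
qed

lemma cont_h: "t \<ge> 0 \<Longrightarrow> continuous_on UNIV (\<lambda>x. h x t)"
  and cont_h1: "t \<ge> 0 \<Longrightarrow> continuous_on UNIV (pdx i (\<lambda>y. h y t))"
  and cont_h2: "t \<ge> 0 \<Longrightarrow> continuous_on UNIV (pdx i (pdx j (\<lambda>y. h y t)))"
  and cont_ht: "t \<ge> 0 \<Longrightarrow> continuous_on UNIV (\<lambda>x. pdt h x t)"
  using c21 slice_continuous[of h t] slice_continuous[of "\<lambda>x t. pdx i (\<lambda>y. h y t) x" t]
    slice_continuous[of "\<lambda>x t. pdx i (pdx j (\<lambda>y. h y t)) x" t] slice_continuous[of "pdt h" t]
  unfolding C21_def by auto

section \<open>The inverse metric, its derivative, and bounds for the coefficients of the
  equation\<close>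

lemma ginv_inverse:
  assumes "t \<ge> 0"
  shows "ginv h x t ** (mat 1 + h x t) = mat 1" "(mat 1 + h x t) ** ginv h x t = mat 1"
    "norm (ginv h x t) \<le> C" "norm (ginv h x t - mat 1) \<le> C * norm (h x t)"
  using inv[OF small[OF assms]] by (auto simp: ginv_def)

lemma cont_ginv:
  assumes "t \<ge> 0" shows "continuous_on UNIV (\<lambda>x. ginv h x t)"
  unfolding ginv_def continuous_on_def
proof
  fix x :: "real^'n"
  have "((\<lambda>y. mat 1 + h y t) \<longlongrightarrow> mat 1 + h x t) (at x)"
    using cont_h[OF assms] by (intro tendsto_intros) (auto simp: continuous_on_def)
  then show "((\<lambda>y. matrix_inv (mat 1 + h y t)) \<longlongrightarrow> matrix_inv (mat 1 + h x t)) (at x within UNIV)"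
    by (rule matrix_inv_continuous) (use ginv_inverse[OF assms] in \<open>auto simp: ginv_def\<close>)
qed

lemma has_pd_ginv:
  assumes "t \<ge> 0" shows "has_pd (\<lambda>y. ginv h y t) (dginv a x t) a x"
proof -
  have "has_pd (\<lambda>y. mat 1 + h y t) (0 + pdx a (\<lambda>y. h y t) x) a x"
    by (intro has_pd_add has_pd_const has_pd_h assms)
  then have "((\<lambda>s. mat 1 + h (x + s *\<^sub>R axis a 1) t) has_vector_derivative pdx a (\<lambda>y. h y t) x) (at 0)"
    by (simp add: has_pd_def)
  from matrix_inv_has_vector_derivative[OF this, of C] ginv_inverse[OF assms]
  show ?thesis by (simp add: has_pd_def dginv_def ginv_def)
qed

lemma cont_dginv: "t \<ge> 0 \<Longrightarrow> continuous_on UNIV (\<lambda>x. dginv a x t)"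
  unfolding dginv_def
  by (intro continuous_on_minus bounded_bilinear.continuous_on[OF bounded_bilinear_matrix_mult] cont_ginv cont_h1)

lemma D_bounds: "D \<ge> 1" "C \<le> D" "C * C * K * K \<le> D" "5 * C\<^sup>2 * real CARD('n)^6 \<le> D"
proof -
  have "C * (C * K * K) \<ge> C * 1" using C1 K1 by (intro mult_left_mono) (auto intro!: mult_ge1_I)
  then have a: "C * C * K * K \<ge> C" by (simp add: mult_ac)
  have b: "5 * C\<^sup>2 * real CARD('n)^6 \<ge> 0" by simp
  show "C * C * K * K \<le> D" "C \<le> D" "D \<ge> 1" using a b C1 unfolding D_def by linarith+
  have "0 \<le> C * C * K * K" using C1 K1 by simp
  then show "5 * C\<^sup>2 * real CARD('n)^6 \<le> D" by (simp add: D_def)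
qed

lemma norm_ginv_diff: "t \<ge> 0 \<Longrightarrow> norm (ginv h x t - mat 1) \<le> D * norm (h x t)"
  using ginv_inverse(4)[of t x] D_bounds(2) mult_right_mono[of C D "norm (h x t)"] by fastforce

lemma norm_dginv:
  assumes "t \<ge> 0" shows "norm (dginv a x t) \<le> D * norm (pdx a (\<lambda>y. h y t) x)"
proof -
  have "norm (dginv a x t) \<le> norm (ginv h x t ** pdx a (\<lambda>y. h y t) x) * norm (ginv h x t) * K"
    unfolding dginv_def norm_minus_cancel by (rule mult_le)
  also have "\<dots> \<le> (C * norm (pdx a (\<lambda>y. h y t) x) * K) * C * K"
    using ginv_inverse(3)[OF assms, of x] C1 K1 by (intro mult_mono order.trans[OF mult_le]) auto
  also have "\<dots> = (C * C * K * K) * norm (pdx a (\<lambda>y. h y t) x)" by (simp add: mult_ac)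
  also have "\<dots> \<le> D * norm (pdx a (\<lambda>y. h y t) x)" using D_bounds by (intro mult_right_mono) auto
  finally show ?thesis .
qed

lemma Dh_le: "\<bar>Dh h c i j x t\<bar> \<le> sqrt (grad_sq h x t)"
proof -
  have "\<bar>Dh h c i j x t\<bar> \<le> norm (pdx c (\<lambda>y. h y t) x)"
    unfolding Dh_def by (rule abs_entry_le_norm)
  also have "\<dots> \<le> sqrt (grad_sq h x t)"
    unfolding grad_sq_def by (intro real_le_rsqrt member_le_sum) auto
  finally show ?thesis .
qed

text \<open>The coefficients in the bracket add up to 1 + 2 + 2 + 2 + 2 = 9; halved, this gives 9/2,
  rounded up to 5. The fourfold sum and the two free indices account for the sixth power of the
  dimension.\<close>

lemma norm_quad:
  assumes "t \<ge> 0" shows "norm (quad h x t) \<le> D * grad_sq h x t"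
proof -
  define S where "S = grad_sq h x t"
  have S0: "S \<ge> 0" by (simp add: S_def grad_sq_def sum_nonneg)
  have DD: "\<bar>Dh h c i j x t * Dh h c' i' j' x t\<bar> \<le> S" for c i j c' i' j'
  proof -
    have "\<bar>Dh h c i j x t * Dh h c' i' j' x t\<bar> \<le> sqrt S * sqrt S"
      unfolding abs_mult S_def by (intro mult_mono Dh_le) (use S0 S_def in auto)
    then show ?thesis using S0 by simp
  qed
  have gg: "\<bar>ginv h x t $ a $ b\<bar> \<le> C" for a b
    using abs_entry_le_norm[of "ginv h x t" a b] ginv_inverse(3)[OF assms, of x] by simp
  have e: "\<bar>quad h x t $ i $ j\<bar> \<le> (9/2) * C\<^sup>2 * real CARD('n)^4 * S" for i j
  proof -
    let ?f = "\<lambda>a b p q. ginv h x t $ a $ b * ginv h x t $ p $ q *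
        (Dh h i p a x t * Dh h j q b x t
         + 2 * Dh h a j p x t * Dh h q i b x t
         - 2 * Dh h a j p x t * Dh h b i q x t
         - 2 * Dh h j p a x t * Dh h b i q x t
         - 2 * Dh h i p a x t * Dh h b j q x t)"
    have f: "\<bar>?f a b p q\<bar> \<le> C\<^sup>2 * (9 * S)" for a b p q
    proof -
      have "\<bar>Dh h i p a x t * Dh h j q b x t
         + 2 * Dh h a j p x t * Dh h q i b x t
         - 2 * Dh h a j p x t * Dh h b i q x t
         - 2 * Dh h j p a x t * Dh h b i q x t
         - 2 * Dh h i p a x t * Dh h b j q x t\<bar> \<le> 9 * S"
        using DD[of i p a j q b] DD[of a j p q i b] DD[of a j p b i q] DD[of j p a b i q] DD[of i p a b j q]
        unfolding mult.assoc abs_le_iff by linarith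
      moreover have "\<bar>ginv h x t $ a $ b * ginv h x t $ p $ q\<bar> \<le> C\<^sup>2"
        unfolding abs_mult power2_eq_square using C1 by (intro mult_mono gg) auto
      ultimately show ?thesis
        unfolding abs_mult[of "_ * _" "_ - _"] by (intro mult_mono) auto
    qed
    have "\<bar>\<Sum>a\<in>UNIV. \<Sum>b\<in>UNIV. \<Sum>p\<in>UNIV. \<Sum>q\<in>UNIV. ?f a b p q\<bar>
       \<le> (\<Sum>a\<in>(UNIV::'n set). \<Sum>b\<in>(UNIV::'n set). \<Sum>p\<in>(UNIV::'n set). \<Sum>q\<in>(UNIV::'n set). C\<^sup>2 * (9 * S))"
      by (intro order.trans[OF sum_abs] sum_mono f)
    also have "\<dots> = real CARD('n)^4 * (C\<^sup>2 * (9 * S))"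
      by (simp add: power4_eq_xxxx mult_ac)
    finally show ?thesis unfolding quad_def by (simp add: mult_ac)
  qed
  have "norm (quad h x t) \<le> (\<Sum>i\<in>(UNIV::'n set). \<Sum>j\<in>(UNIV::'n set). (9/2) * C\<^sup>2 * real CARD('n)^4 * S)"
    by (intro order.trans[OF norm_le_sum_entries] sum_mono e)
  also have "\<dots> = (9/2) * (C\<^sup>2 * real CARD('n)^6 * S)"
    by (simp add: power_numeral_reduce mult_ac)
  also have "\<dots> \<le> 5 * (C\<^sup>2 * real CARD('n)^6 * S)"
    using S0 by (intro mult_right_mono) auto
  also have "\<dots> = (5 * C\<^sup>2 * real CARD('n)^6) * S" by simp
  also have "\<dots> \<le> D * S" using D_bounds S0 by (intro mult_right_mono) auto
  finally show ?thesis by (simp add: S_def)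
qed

text \<open>The terms \<open>\<nabla>\<^sub>a (\<delta> + h)\<^sup>a\<^sup>b \<nabla>\<^sub>b h\<close> of \<open>Q0\<close> and of the divergence of \<open>Q1\<close> cancel, so no
  derivative of the inverse metric is left.\<close>

lemma nondivergence_form:
  assumes t: "t \<ge> 0"
  shows "pdt h x t = (\<Sum>a\<in>UNIV. \<Sum>b\<in>UNIV. ginv h x t $ a $ b *\<^sub>R pdx a (pdx b (\<lambda>y. h y t)) x) + quad h x t"
proof -
  have "pdt h x t $ i $ j = (\<Sum>a\<in>UNIV. \<Sum>b\<in>UNIV. ginv h x t $ a $ b * pdx a (pdx b (\<lambda>y. h y t)) x $ i $ j)
      + quad h x t $ i $ j" for i j
  proof -
    define H2 where "H2 a b = pdx a (pdx b (\<lambda>y. h y t)) x $ i $ j" for a b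
    have q1: "pdx a (\<lambda>y. Q1 h a i j y t) x
      = (\<Sum>b\<in>UNIV. (ginv h x t $ a $ b - mat 1 $ a $ b) * H2 a b + dginv a x t $ a $ b * Dh h b i j x t)" for a
    proof (rule has_pd_pdx)
      have "has_pd (\<lambda>y. (ginv h y t $ a $ b - mat 1 $ a $ b) * Dh h b i j y t)
         ((ginv h x t $ a $ b - mat 1 $ a $ b) * H2 a b + (dginv a x t $ a $ b - 0) * Dh h b i j x t) a x" for b
        unfolding Dh_def H2_def
        by (intro has_pd_mult has_pd_diff has_pd_const has_pd_entry has_pd_ginv has_pd_h2 t)
      then show "has_pd (\<lambda>y. Q1 h a i j y t)
        (\<Sum>b\<in>UNIV. (ginv h x t $ a $ b - mat 1 $ a $ b) * H2 a b + dginv a x t $ a $ b * Dh h b i j x t) a x"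
        unfolding Q1_def by (intro has_pd_sum) simp
    qed
    have dg: "pdx a (\<lambda>y. ginv h y t) x = dginv a x t" for a
      by (intro has_pd_pdx has_pd_ginv t)
    \<comment> \<open>The part of \<open>Q1\<close> with \<open>mat 1\<close> subtracts a Euclidean
      Laplacian, which compensates the one on the left-hand side of the equation. The full inverse
      metric remains as coefficient.\<close>
    have delta: "(\<Sum>a\<in>UNIV. \<Sum>b\<in>UNIV. mat 1 $ a $ b * H2 a b) = (\<Sum>a\<in>UNIV. H2 a a)"
      by (simp add: mat_def if_distrib[of "\<lambda>z. z * _"] sum.delta cong: if_cong)
    have "pdt h x t $ i $ j = (\<Sum>a\<in>UNIV. H2 a a) + (Q0 h i j x t + (\<Sum>a\<in>UNIV. pdx a (\<lambda>y. Q1 h a i j y t) x))"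
    proof -
      have "pdt h x t $ i $ j - (\<Sum>a\<in>UNIV. H2 a a) = Q0 h i j x t + (\<Sum>a\<in>UNIV. pdx a (\<lambda>y. Q1 h a i j y t) x)"
        using rd t unfolding ricci_deturck_def H2_def by blast
      then show ?thesis by linarith
    qed
    also have "\<dots> = (\<Sum>a\<in>UNIV. \<Sum>b\<in>UNIV. ginv h x t $ a $ b * H2 a b) + quad h x t $ i $ j"
      unfolding q1 Q0_def dg quad_def
      by (simp add: sum.distrib left_diff_distrib sum_subtractf delta)
    finally show ?thesis by (simp add: H2_def)
  qed
  then show ?thesis by (simp add: vec_eq_iff)
qed

end

section \<open>Weighted integrals along the flow\<close>

text \<open>\<open>\<omega>\<close> dominates both |\<nabla>\<phi>|^2 / \<phi> and |\<Delta>\<phi>|,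
  the two ways in which the weight enters the error. \<open>\<omega>_le\<close> splits the error
  into a multiple of the weighted integral, handled by Gronwall's inequality, and a constant on a
  ball, which must be small against the volume of the ball.\<close>

locale cutoff =
  fixes \<phi> \<omega> :: "real^'n::finite \<Rightarrow> real" and \<phi>1 \<phi>2 :: "'n \<Rightarrow> real^'n \<Rightarrow> real" and R \<mu> \<kappa> :: real
  assumes \<phi>_pd: "\<And>a x. has_pd \<phi> (\<phi>1 a x) a x" and \<phi>1_pd: "\<And>a x. has_pd (\<phi>1 a) (\<phi>2 a x) a x"
    and \<phi>_cont: "continuous_on UNIV \<phi>" "\<And>a. continuous_on UNIV (\<phi>1 a)" "\<And>a. continuous_on UNIV (\<phi>2 a)"
    and \<phi>_zero: "\<And>x. norm x \<ge> R \<Longrightarrow> \<phi> x = 0" "\<And>x a. norm x \<ge> R \<Longrightarrow> \<phi>1 a x = 0" "\<And>x a. norm x \<ge> R \<Longrightarrow> \<phi>2 a x = 0"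
    and \<phi>_nonneg: "\<And>x. \<phi> x \<ge> 0" and \<omega>_nonneg: "\<And>x. \<omega> x \<ge> 0"
    and \<phi>_grad: "\<And>x. (\<Sum>a\<in>UNIV. (\<phi>1 a x)\<^sup>2) \<le> \<phi> x * \<omega> x"
    and \<phi>_laplace: "\<And>x. \<bar>\<Sum>a\<in>UNIV. \<phi>2 a x\<bar> \<le> \<omega> x"
    and \<omega>_le: "\<And>x. \<omega> x \<le> \<mu> * \<phi> x + \<kappa> * indicator (cball 0 R) x"
    and \<mu>\<kappa>: "\<mu> \<ge> 0" "\<kappa> \<ge> 0"

text \<open>\<open>\<eta>\<close> keeps the argument of \<open>G\<close> away from 0, where powers
  are not smooth, and \<open>V\<close> bounds it from above. \<open>G_cond\<close> is the sign
  condition on the factor of the squared gradient, and \<open>G_growth\<close> controls the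
  gradient-free error by the integrand itself.\<close>

locale entropy = small_ricci_deturck h C K for h :: "real^'n::finite \<Rightarrow> real \<Rightarrow> real^'n^'n" and C K +
  fixes G G1 G2 :: "real \<Rightarrow> real" and \<eta> V L :: real
  assumes \<eta>: "\<eta> > 0" and L: "L \<ge> 0"
    and G_deriv: "\<And>v. v > 0 \<Longrightarrow> (G has_real_derivative G1 v) (at v)"
    and G1_deriv: "\<And>v. v > 0 \<Longrightarrow> (G1 has_real_derivative G2 v) (at v)"
    and G2_cont: "continuous_on {0<..} G2"
    and G1_nonneg: "\<And>v. 0 < v \<Longrightarrow> v \<le> V \<Longrightarrow> G1 v \<ge> 0"
    and G_cond: "\<And>v. 0 < v \<Longrightarrow> v \<le> V \<Longrightarrow> 4 * v * max 0 (- G2 v) \<le> 2 * G1 v - 9 * D * CARD('n) * G1 v * sqrt v"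
    and G_growth: "\<And>v. \<eta> \<le> v \<Longrightarrow> v \<le> V \<Longrightarrow> G1 v * (v - \<eta>) \<le> L * (G v - G \<eta>)"
    and V_small: "9 * D * CARD('n) * sqrt V \<le> 1"
    and h_small: "\<And>x t. t \<ge> 0 \<Longrightarrow> inner (h x t) (h x t) + \<eta> \<le> V"
begin

definition v :: "real^'n \<Rightarrow> real \<Rightarrow> real" where "v x t = inner (h x t) (h x t) + \<eta>"

text \<open>Subtracting \<open>G \<eta>\<close> makes the integrand vanish where h vanishes;
  monotonicity of \<open>G\<close> then makes it nonnegative.\<close>

definition F :: "real^'n \<Rightarrow> real \<Rightarrow> real" where "F x t = G (v x t) - G \<eta>"

definition Ft :: "real^'n \<Rightarrow> real \<Rightarrow> real" where "Ft x t = 2 * G1 (v x t) * inner (h x t) (pdt h x t)"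

lemma v_bounds: "v x t \<ge> \<eta>" "v x t > 0" "t \<ge> 0 \<Longrightarrow> v x t \<le> V"
  using \<eta> h_small[of t x] by (auto simp: v_def intro: add_nonneg_pos)

lemma G_cont: "continuous_on {0<..} G" "continuous_on {0<..} G1"
  using G_deriv G1_deriv by (auto intro!: DERIV_continuous_on intro: has_field_derivative_at_within)

lemma G_mono: assumes "0 < a" "a \<le> b" "b \<le> V" shows "G a \<le> G b"
  using assms by (intro DERIV_nonneg_imp_nondecreasing[of a b G]) (auto intro!: exI G_deriv G1_nonneg)

lemma F_nonneg: "t \<ge> 0 \<Longrightarrow> F x t \<ge> 0"
  using G_mono[OF \<eta> v_bounds(1) v_bounds(3)] by (simp add: F_def)

lemma F_le: "t \<ge> 0 \<Longrightarrow> F x t \<le> G V - G \<eta>"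
  using G_mono[OF v_bounds(2) v_bounds(3) order_refl] by (simp add: F_def)

lemma G1_F: "t \<ge> 0 \<Longrightarrow> G1 (v x t) * inner (h x t) (h x t) \<le> L * F x t"
  using G_growth[OF v_bounds(1) v_bounds(3), of t x] by (simp add: F_def v_def)

lemma cont_v: "t \<ge> 0 \<Longrightarrow> continuous_on UNIV (\<lambda>x. v x t)"
  unfolding v_def by (intro continuous_intros cont_h)

lemma cont_Gv:
  assumes "t \<ge> 0"
  shows "continuous_on UNIV (\<lambda>x. G (v x t))" "continuous_on UNIV (\<lambda>x. G1 (v x t))" "continuous_on UNIV (\<lambda>x. G2 (v x t))"
  using v_bounds(2) by (auto intro!: continuous_on_compose2[OF G_cont(1) cont_v[OF assms]]
      continuous_on_compose2[OF G_cont(2) cont_v[OF assms]] continuous_on_compose2[OF G2_cont cont_v[OF assms]])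

lemma cont_F: "t \<ge> 0 \<Longrightarrow> continuous_on UNIV (\<lambda>x. F x t)"
  unfolding F_def by (intro continuous_intros cont_Gv)

lemma cont_Ft: "t \<ge> 0 \<Longrightarrow> continuous_on UNIV (\<lambda>x. Ft x t)"
  unfolding Ft_def by (intro continuous_intros cont_Gv cont_h cont_ht)

lemma has_pd_v: "t \<ge> 0 \<Longrightarrow> has_pd (\<lambda>y. v y t) (2 * inner (h x t) (pdx a (\<lambda>y. h y t) x)) a x"
  unfolding v_def
  by (rule has_pd_eq[OF has_pd_add[OF has_pd_inner[OF has_pd_h has_pd_h] has_pd_const]])
    (auto simp: inner_commute)

lemma has_pd_F: "t \<ge> 0 \<Longrightarrow> has_pd (\<lambda>y. F y t) (2 * G1 (v x t) * inner (h x t) (pdx a (\<lambda>y. h y t) x)) a x"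
  unfolding F_def
  by (rule has_pd_eq[OF has_pd_diff[OF has_pd_compose[OF has_pd_v G_deriv] has_pd_const]])
    (auto simp: v_bounds)

lemma has_pd_F2: "t \<ge> 0 \<Longrightarrow> has_pd (\<lambda>y. 2 * G1 (v y t) * inner (h y t) (pdx b (\<lambda>y. h y t) y))
   (4 * G2 (v x t) * inner (h x t) (pdx a (\<lambda>y. h y t) x) * inner (h x t) (pdx b (\<lambda>y. h y t) x)
    + 2 * G1 (v x t) * (inner (pdx a (\<lambda>y. h y t) x) (pdx b (\<lambda>y. h y t) x)
        + inner (h x t) (pdx a (pdx b (\<lambda>y. h y t)) x))) a x"
  by (rule has_pd_eq[OF has_pd_mult[OF has_pd_mult[OF has_pd_const has_pd_compose[OF has_pd_v G1_deriv]]
     has_pd_inner[OF has_pd_h has_pd_h2]]])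
    (auto simp: v_bounds algebra_simps)

lemma F_has_derivative_time:
  assumes "t \<ge> 0" shows "((\<lambda>s. F x s) has_real_derivative Ft x t) (at t within {0..})"
proof -
  have d: "((\<lambda>s. h x s) has_vector_derivative pdt h x t) (at t within {0..})"
    using c21 assms unfolding C21_def by blast
  have "((\<lambda>s. v x s) has_vector_derivative (inner (h x t) (pdt h x t) + inner (pdt h x t) (h x t)) + 0) (at t within {0..})"
    unfolding v_def
    by (intro has_vector_derivative_add has_vector_derivative_const
       bounded_bilinear.has_vector_derivative[OF bounded_bilinear_inner] d)
  then have "((\<lambda>s. v x s) has_real_derivative 2 * inner (h x t) (pdt h x t)) (at t within {0..})"
    by (simp add: has_real_derivative_iff_has_vector_derivative inner_commute)
  then have "((\<lambda>s. G (v x s)) has_real_derivative G1 (v x t) * (2 * inner (h x t) (pdt h x t))) (at t within {0..})"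
    by (intro DERIV_chain2[OF G_deriv]) (auto simp: v_bounds)
  then have "((\<lambda>s. G (v x s) - G \<eta>) has_real_derivative G1 (v x t) * (2 * inner (h x t) (pdt h x t)) - 0) (at t within {0..})"
    by (intro DERIV_diff DERIV_const)
  then show ?thesis by (simp add: F_def Ft_def mult_ac)
qed

text \<open>Time comes first here, the order of variables in which the Leibniz rule wants joint
  continuity.\<close>

lemma cont_Ft_joint: "continuous_on ({0..} \<times> UNIV) (\<lambda>(t, x). Ft x t)"
proof -
  have sw: "continuous_on ({0..} \<times> UNIV) (\<lambda>z. f (snd z) (fst z))"
    if "continuous_on (UNIV \<times> {0..}) (\<lambda>(x, t). f x t)" for f :: "real^'n \<Rightarrow> real \<Rightarrow> real^'n^'n"
  proof -
    have "continuous_on ({0..} \<times> UNIV) (\<lambda>z::real \<times> (real^'n). (snd z, fst z))" by (intro continuous_intros)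
    moreover have "(\<lambda>z::real \<times> (real^'n). (snd z, fst z)) ` ({0..} \<times> UNIV) \<subseteq> UNIV \<times> {0..}" by auto
    ultimately show ?thesis using continuous_on_compose2[OF that] by fastforce
  qed
  have c: "continuous_on ({0..} \<times> UNIV) (\<lambda>z. h (snd z) (fst z))"
      "continuous_on ({0..} \<times> UNIV) (\<lambda>z. pdt h (snd z) (fst z))"
    using c21 unfolding C21_def by (blast intro: sw)+
  have "continuous_on ({0..} \<times> UNIV) (\<lambda>z. v (snd z) (fst z))"
    unfolding v_def by (intro continuous_intros c)
  then have "continuous_on ({0..} \<times> UNIV) (\<lambda>z. G1 (v (snd z) (fst z)))"
    by (rule continuous_on_compose2[OF G_cont(2)]) (auto simp: v_bounds)
  then show ?thesis
    unfolding Ft_def split_beta by (intro continuous_intros c)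
qed

end

section \<open>The weighted integral and its time derivative\<close>

locale weighted_entropy = entropy h C K G G1 G2 \<eta> V L + cutoff \<phi> \<omega> \<phi>1 \<phi>2 R \<mu> \<kappa>
  for h :: "real^'n::finite \<Rightarrow> real \<Rightarrow> real^'n^'n" and C K G G1 G2 \<eta> V L
    and \<phi> \<omega> :: "real^'n \<Rightarrow> real" and \<phi>1 \<phi>2 R \<mu> \<kappa>
begin

definition mass :: "real \<Rightarrow> real" where "mass t = (\<integral>x. \<phi> x * F x t \<partial>lborel)"

definition Dmass :: "real \<Rightarrow> real" where "Dmass t = (\<integral>x. \<phi> x * Ft x t \<partial>lborel)"

lemma support_box: obtains a b :: "real^'n" where "\<And>x. x \<notin> cbox a b \<Longrightarrow> norm x \<ge> R"
proof -
  obtain a b :: "real^'n" where "cball 0 R \<subseteq> cbox a b"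
    using bounded_cball bounded_subset_cbox_symmetric by blast
  then have "norm x \<ge> R" if "x \<notin> cbox a b" for x using that by (force simp: subset_eq)
  then show ?thesis using that by blast
qed

text \<open>All integrands vanish outside one fixed box, so the Leibniz rule on that box
  applies.\<close>

lemma mass_has_derivative:
  assumes "t \<ge> 0" shows "(mass has_real_derivative Dmass t) (at t within {0..})"
proof -
  obtain a b :: "real^'n" where ab: "\<And>x. x \<notin> cbox a b \<Longrightarrow> norm x \<ge> R" using support_box by blast
  have c: "mass s = integral (cbox a b) (\<lambda>x. \<phi> x * F x s)" "(\<lambda>x. \<phi> x * F x s) integrable_on cbox a b"
    "Dmass s = integral (cbox a b) (\<lambda>x. \<phi> x * Ft x s)" if "s \<ge> 0" for s
    unfolding mass_def Dmass_def
    using that ab \<phi>_zero by (auto intro!: continuous_compact_support continuous_intros \<phi>_cont cont_F cont_Ft)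
  have "((\<lambda>s. integral (cbox a b) (\<lambda>x. \<phi> x * F x s)) has_real_derivative integral (cbox a b) (\<lambda>x. \<phi> x * Ft x t)) (at t within {0..})"
  proof (rule leibniz_rule_field_derivative)
    fix s x assume "s \<in> {0::real..}"
    then show "((\<lambda>s. \<phi> x * F x s) has_real_derivative \<phi> x * Ft x s) (at s within {0..})"
      by (intro DERIV_cmult F_has_derivative_time) auto
  next
    have "continuous_on ({0..} \<times> cbox a b) (\<lambda>z. \<phi> (snd z) * (\<lambda>(t, x). Ft x t) z)"
      by (intro continuous_intros continuous_on_subset[OF cont_Ft_joint] continuous_on_compose2[OF \<phi>_cont(1)]) auto
    then show "continuous_on ({0..} \<times> cbox a b) (\<lambda>(s, x). \<phi> x * Ft x s)"
      by (simp add: split_beta)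
  qed (use c assms in auto)
  then have "((\<lambda>s. integral (cbox a b) (\<lambda>x. \<phi> x * F x s)) has_real_derivative Dmass t) (at t within {0..})"
    using c assms by simp
  then show ?thesis
    by (rule has_field_derivative_transform_within[of _ _ _ _ 1]) (use assms c in auto)
qed

text \<open>The divergence of the field \<open>W\<close> integrates to zero and may be subtracted.
  By \<open>pointwise_divergence_bound\<close> the new integrand is at most \<open>\<omega>\<close>
  times a multiple of \<open>F\<close>, with no gradient of h left, and \<open>\<omega>_le\<close>
  finishes the estimate.\<close>

lemma Dmass_le:
  assumes t: "t \<ge> 0"
  shows "Dmass t \<le> (1 + L) * (\<mu> * mass t + \<kappa> * (G V - G \<eta>) * measure lborel (cball (0::real^'n) R))"
proof -
  obtain a b :: "real^'n" where ab: "\<And>x. x \<notin> cbox a b \<Longrightarrow> norm x \<ge> R" using support_box by blast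
  define X1 where "X1 c x = pdx c (\<lambda>y. h y t) x" for c x
  define X2 where "X2 c d x = pdx c (pdx d (\<lambda>y. h y t)) x" for c d x
  define \<xi> where "\<xi> c x = inner (h x t) (X1 c x)" for c x
  define W' where "W' c x = \<phi>1 c x * (\<Sum>b\<in>UNIV. ginv h x t $ c $ b * (2 * G1 (v x t) * \<xi> b x))
          + \<phi> x * (\<Sum>b\<in>UNIV. dginv c x t $ c $ b * (2 * G1 (v x t) * \<xi> b x)
               + ginv h x t $ c $ b * (4 * G2 (v x t) * \<xi> c x * \<xi> b x + 2 * G1 (v x t) * (inner (X1 c x) (X1 b x) + inner (h x t) (X2 c b x))))
          - (2 * G1 (v x t) * \<xi> c x) * \<phi>1 c x - F x t * \<phi>2 c x" for c x
  define W where "W c x = \<phi> x * (\<Sum>b\<in>UNIV. ginv h x t $ c $ b * (2 * G1 (v x t) * \<xi> b x)) - F x t * \<phi>1 c x" for c x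
  have cX: "continuous_on UNIV (X1 c)" "continuous_on UNIV (X2 c d)" "continuous_on UNIV (\<xi> c)" for c d
  proof -
    show 1: "continuous_on UNIV (X1 c)" for c unfolding X1_def using cont_h1[OF t] by simp
    show "continuous_on UNIV (X2 c d)" unfolding X2_def using cont_h2[OF t] by simp
    show "continuous_on UNIV (\<xi> c)" unfolding \<xi>_def by (intro continuous_intros 1 cont_h t)
  qed
  have cW: "continuous_on UNIV (W c)" for c
    unfolding W_def by (intro continuous_intros \<phi>_cont cX cont_Gv cont_F cont_ginv t)
  have cW': "continuous_on UNIV (W' c)" for c
    unfolding W'_def by (intro continuous_intros \<phi>_cont cX cont_Gv cont_F cont_ginv cont_dginv cont_h t)
  have zW: "W c x = 0" "W' c x = 0" if "norm x \<ge> R" for c x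
    using \<phi>_zero that by (auto simp: W_def W'_def)
  have dW: "has_pd (W c) (W' c x) c x" for c x
  proof -
    have s: "has_pd (\<lambda>y. \<Sum>b\<in>UNIV. ginv h y t $ c $ b * (2 * G1 (v y t) * \<xi> b y))
      (\<Sum>b\<in>UNIV. ginv h x t $ c $ b * (4 * G2 (v x t) * \<xi> c x * \<xi> b x + 2 * G1 (v x t) * (inner (X1 c x) (X1 b x) + inner (h x t) (X2 c b x)))
        + dginv c x t $ c $ b * (2 * G1 (v x t) * \<xi> b x)) c x"
      unfolding \<xi>_def X1_def X2_def
      by (intro has_pd_sum has_pd_mult has_pd_entry has_pd_ginv has_pd_F2 t)
    show ?thesis unfolding W_def
      by (rule has_pd_eq[OF has_pd_diff[OF has_pd_mult[OF \<phi>_pd s] has_pd_mult[OF has_pd_F[OF t] \<phi>1_pd]]])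
        (simp add: W'_def \<xi>_def X1_def sum.distrib algebra_simps)
  qed
  have intW': "(\<integral>x. W' c x \<partial>lborel) = 0" for c
    by (rule integral_pd_zero[OF cW cW' dW zW])
  have iW': "integrable lborel (W' c)" for c
    by (rule continuous_compact_support(1)[OF cW', of a b]) (use ab zW in auto)
  have iFt: "integrable lborel (\<lambda>x. \<phi> x * Ft x t)"
    by (rule continuous_compact_support(1)[of _ a b])
      (use ab \<phi>_zero in \<open>auto intro!: continuous_intros \<phi>_cont cont_Ft t\<close>)
  have iF: "integrable lborel (\<lambda>x. \<phi> x * F x t)"
    by (rule continuous_compact_support(1)[of _ a b])
      (use ab \<phi>_zero in \<open>auto intro!: continuous_intros \<phi>_cont cont_F t\<close>)
  have "Dmass t = (\<integral>x. \<phi> x * Ft x t - (\<Sum>c\<in>UNIV. W' c x) \<partial>lborel)"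
    using iFt iW' intW' by (simp add: Dmass_def)
  also have "\<dots> \<le> (\<integral>x. (1 + L) * (\<mu> * (\<phi> x * F x t) + \<kappa> * (G V - G \<eta>) * indicator (cball 0 R) x) \<partial>lborel)"
  proof (rule integral_mono)
    show "integrable lborel (\<lambda>x. \<phi> x * Ft x t - (\<Sum>c\<in>UNIV. W' c x))"
      using iFt iW' by simp
    show "integrable lborel (\<lambda>x. (1 + L) * (\<mu> * (\<phi> x * F x t) + \<kappa> * (G V - G \<eta>) * indicator (cball 0 R) x))"
      using iF by (auto intro!: integrable_add integrable_mult_right integrable_real_indicator emeasure_compact_finite)
    fix x
    define r where "r = norm (h x t)"
    have r0: "r \<ge> 0" and rv: "r\<^sup>2 \<le> v x t" using \<eta> by (auto simp: r_def v_def dot_square_norm)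
    have rv': "r \<le> sqrt (v x t)" using rv r0 real_le_rsqrt by blast
    define C3 where "C3 = 9 * D * real CARD('n)"
    have C30: "C3 \<ge> 0" using D_bounds by (simp add: C3_def)
    have G1v: "G1 (v x t) \<ge> 0" using v_bounds t by (intro G1_nonneg) auto
    have sm: "C3 * r \<le> 1"
    proof -
      have "C3 * r \<le> C3 * sqrt V"
        using C30 by (intro mult_left_mono order.trans[OF rv' real_sqrt_le_mono[OF v_bounds(3)[OF t]]])
      then show ?thesis using V_small by (simp add: C3_def)
    qed
    \<comment> \<open>\<open>G_cond\<close> speaks about the regularised argument \<open>v\<close>;
      it passes to \<open>r\<close> because \<open>r\<^sup>2 \<le> v\<close> makes the left-hand
      side smaller and the right-hand side larger.\<close>
    have Gc: "4 * r\<^sup>2 * max 0 (- G2 (v x t)) \<le> 2 * G1 (v x t) - C3 * G1 (v x t) * r"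
    proof -
      have "4 * r\<^sup>2 * max 0 (- G2 (v x t)) \<le> 4 * v x t * max 0 (- G2 (v x t))"
        using rv by (intro mult_right_mono) auto
      also have "\<dots> \<le> 2 * G1 (v x t) - C3 * G1 (v x t) * sqrt (v x t)"
        using G_cond[of "v x t"] v_bounds t by (simp add: C3_def)
      also have "\<dots> \<le> 2 * G1 (v x t) - C3 * G1 (v x t) * r"
        using rv' C30 G1v by (intro diff_left_mono mult_left_mono) auto
      finally show ?thesis .
    qed
    have "\<phi> x * Ft x t - (\<Sum>c\<in>UNIV. W' c x) \<le> \<omega> x * (F x t + C3 * G1 (v x t) * r^3)"
      unfolding W'_def Ft_def nondivergence_form[OF t] C3_def r_def \<xi>_def
      unfolding X1_def[symmetric] X2_def[symmetric]
      by (rule pointwise_divergence_bound)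
        (use D_bounds norm_ginv_diff[OF t] norm_dginv[OF t] norm_quad[OF t] \<phi>_nonneg \<omega>_nonneg \<phi>_grad \<phi>_laplace F_nonneg[OF t] G1v sm Gc
          in \<open>auto simp: X1_def grad_sq_def C3_def r_def\<close>)
    also have "\<dots> \<le> \<omega> x * ((1 + L) * F x t)"
    proof (intro mult_left_mono \<omega>_nonneg)
      \<comment> \<open>One factor \<open>r\<close> is given up against \<open>C3\<close>, since
        \<open>G_growth\<close> controls exactly \<open>G1\<close> times the squared norm.\<close>
      have "C3 * G1 (v x t) * r^3 = (C3 * r) * (G1 (v x t) * r\<^sup>2)" by (simp add: power2_eq_square power3_eq_cube)
      also have "\<dots> \<le> 1 * (G1 (v x t) * r\<^sup>2)" using sm G1v by (intro mult_right_mono) auto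
      also have "\<dots> \<le> L * F x t" using G1_F[OF t, of x] by (simp add: r_def dot_square_norm)
      finally show "F x t + C3 * G1 (v x t) * r^3 \<le> (1 + L) * F x t" by (simp add: algebra_simps)
    qed
    also have "\<dots> \<le> (\<mu> * \<phi> x + \<kappa> * indicator (cball 0 R) x) * ((1 + L) * F x t)"
      using L F_nonneg[OF t, of x] by (intro mult_right_mono \<omega>_le) auto
    also have "\<dots> = (1 + L) * (\<mu> * (\<phi> x * F x t) + \<kappa> * F x t * indicator (cball 0 R) x)"
      by (simp add: algebra_simps)
    also have "\<dots> \<le> (1 + L) * (\<mu> * (\<phi> x * F x t) + \<kappa> * (G V - G \<eta>) * indicator (cball 0 R) x)"
      using L \<mu>\<kappa> F_le[OF t, of x] by (intro mult_left_mono add_left_mono mult_right_mono) auto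
    finally show "\<phi> x * Ft x t - (\<Sum>c\<in>UNIV. W' c x) \<le> \<dots>" .
  qed
  also have "\<dots> = (1 + L) * (\<mu> * mass t + \<kappa> * (G V - G \<eta>) * measure lborel (cball (0::real^'n) R))"
    using iF emeasure_compact_finite[of "cball (0::real^'n) R"] by (subst integral_mult_right_zero, subst Bochner_Integration.integral_add)
      (auto simp: mass_def intro!: integrable_mult_right integrable_real_indicator)
  finally show ?thesis .
qed

end

section \<open>Weights with compact support\<close>

text \<open>The function \<open>z\<close> with integrating factor
  \<open>exp (- \<Lambda> * s)\<close> is nonincreasing. Estimating that factor by 1 in the
  inhomogeneous term makes the correction simply linear in time.\<close>

lemma gronwall:
  fixes y y' :: "real \<Rightarrow> real"
  assumes d: "\<And>t. t \<ge> 0 \<Longrightarrow> (y has_real_derivative y' t) (at t within {0..})"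
    and le: "\<And>t. t \<ge> 0 \<Longrightarrow> y' t \<le> \<Lambda> * y t + \<kappa>" and nn: "\<Lambda> \<ge> 0" "\<kappa> \<ge> 0" "t \<ge> 0"
  shows "y t \<le> exp (\<Lambda> * t) * (y 0 + \<kappa> * t)"
proof -
  define z where "z s = exp (- \<Lambda> * s) * y s - \<kappa> * s" for s
  have "z t \<le> z 0"
  proof (rule DERIV_nonpos_imp_decreasing_open[of 0 t z])
    have "continuous_on {0..} y" by (rule DERIV_continuous_on[OF d]) auto
    then have cy: "continuous_on {0..t} y" by (rule continuous_on_subset) auto
    show "continuous_on {0..t} z"
      unfolding z_def by (intro continuous_intros cy)
    fix s assume s: "0 < s" "s < t"
    have yd: "(y has_real_derivative y' s) (at s)"
      using d[of s] s at_within_interior[of s "{0..}"] by (simp add: interior_real_atLeast)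
    have "(z has_real_derivative exp (- \<Lambda> * s) * (y' s - \<Lambda> * y s) - \<kappa>) (at s)"
    proof -
      have e: "((\<lambda>s. exp (- \<Lambda> * s)) has_real_derivative exp (- \<Lambda> * s) * (- \<Lambda>)) (at s)"
        by (auto intro!: derivative_eq_intros)
      have "a * (- \<Lambda>) * y s + y' s * a - \<kappa> * 1 = a * (y' s - \<Lambda> * y s) - \<kappa>" for a
        by (simp add: algebra_simps)
      with DERIV_diff[OF DERIV_mult[OF e yd] DERIV_cmult[OF DERIV_ident, of \<kappa>]] show ?thesis
        unfolding z_def by metis
    qed
    moreover have "exp (- \<Lambda> * s) * (y' s - \<Lambda> * y s) \<le> exp (- \<Lambda> * s) * \<kappa>"
      using le[of s] s by (intro mult_left_mono) auto
    moreover have "exp (- \<Lambda> * s) * \<kappa> \<le> 1 * \<kappa>"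
      using nn s by (intro mult_right_mono) auto
    ultimately show "\<exists>d. (z has_real_derivative d) (at s) \<and> d \<le> 0"
      by (intro exI[of _ "exp (- \<Lambda> * s) * (y' s - \<Lambda> * y s) - \<kappa>"] conjI) linarith+
  qed (use nn in auto)
  then have "exp (\<Lambda> * t) * (exp (- \<Lambda> * t) * y t) \<le> exp (\<Lambda> * t) * (y 0 + \<kappa> * t)"
    by (intro mult_left_mono) (auto simp: z_def)
  moreover have "exp (\<Lambda> * t) * (exp (- \<Lambda> * t) * y t) = y t"
    by (simp add: mult.assoc[symmetric] exp_add[symmetric])
  ultimately show ?thesis by metis
qed

lemma (in weighted_entropy) mass_le:
  assumes "t \<ge> 0"
  shows "mass t \<le> exp ((1 + L) * \<mu> * t) * (mass 0 + (1 + L) * (\<kappa> * (G V - G \<eta>) * measure lborel (cball (0::real^'n) R)) * t)"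
proof (rule gronwall)
  fix s :: real assume "s \<ge> 0"
  then show "Dmass s \<le> (1 + L) * \<mu> * mass s + (1 + L) * (\<kappa> * (G V - G \<eta>) * measure lborel (cball (0::real^'n) R))"
    using Dmass_le[of s] by (simp add: algebra_simps)
next
  show "0 \<le> (1 + L) * (\<kappa> * (G V - G \<eta>) * measure lborel (cball (0::real^'n) R))"
  proof -
    have "0 \<le> G V - G \<eta>" using F_nonneg[of 0 undefined] F_le[of 0 undefined] by linarith
    then show ?thesis using L \<mu>\<kappa> by (intro mult_nonneg_nonneg) auto
  qed
qed (use assms L \<mu>\<kappa> mass_has_derivative in auto)

section \<open>The truncated power weight and its derivatives\<close>

lemma max0_power_has_derivative:
  "((\<lambda>z::real. max 0 z ^ Suc (Suc m)) has_real_derivative real (Suc (Suc m)) * max 0 z ^ Suc m) (at z)"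
proof (cases z "0::real" rule: linorder_cases)
  case greater
  have "((\<lambda>z::real. z ^ Suc (Suc m)) has_real_derivative real (Suc (Suc m)) * max 0 z ^ Suc m) (at z)"
    using greater DERIV_pow[of "Suc (Suc m)" z] by (simp add: max_def)
  then show ?thesis
    by (rule has_field_derivative_transform_within_open[of _ _ _ "{0<..}"]) (use greater in auto)
next
  case less
  have "((\<lambda>z::real. 0) has_real_derivative real (Suc (Suc m)) * max 0 z ^ Suc m) (at z)"
    using less by (auto simp: max_def)
  then show ?thesis
    by (rule has_field_derivative_transform_within_open[of _ _ _ "{..<0}"]) (use less in auto)
next
  case equal
  have "((\<lambda>y::real. max 0 y ^ Suc (Suc m) / y) \<longlongrightarrow> 0) (at 0)"
  proof (rule Lim_null_comparison)
    show "((\<lambda>y::real. \<bar>y\<bar> ^ Suc m) \<longlongrightarrow> 0) (at 0)"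
      by (auto intro!: tendsto_eq_intros)
    show "\<forall>\<^sub>F y::real in at 0. norm (max 0 y ^ Suc (Suc m) / y) \<le> \<bar>y\<bar> ^ Suc m"
    proof (intro always_eventually allI)
      fix y :: real
      show "norm (max 0 y ^ Suc (Suc m) / y) \<le> \<bar>y\<bar> ^ Suc m"
      proof (cases "y \<le> 0")
        case True
        then have "norm (max 0 y ^ Suc (Suc m) / y) = 0" by (simp add: max_def)
        then show ?thesis by (simp only: zero_le_power[OF abs_ge_zero])
      qed (simp add: max_def abs_mult)
    qed
  qed
  then show ?thesis using equal by (simp add: DERIV_def)
qed

definition bump :: "real \<Rightarrow> real^'n::finite \<Rightarrow> real" where
  "bump R x = max 0 (1 - inner x x / R\<^sup>2)"

lemma bump_bounds: "0 \<le> bump R x" "bump R x \<le> 1"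
  by (auto simp: bump_def)

lemma bump_cont: "continuous_on UNIV (bump R)"
  unfolding bump_def divide_inverse by (intro continuous_intros)

lemma bump_zero: "R > 0 \<Longrightarrow> norm x \<ge> R \<Longrightarrow> bump R x = 0"
  using power_mono[of R "norm x" 2] by (simp add: bump_def dot_square_norm)

lemma has_pd_bump_power:
  "has_pd (\<lambda>x. bump R x ^ Suc (Suc m)) (- (2 * real (Suc (Suc m)) / R\<^sup>2) * (x $ a * bump R x ^ Suc m)) a x"
proof -
  have ident: "has_pd (\<lambda>y. y) (axis a 1) a x"
    unfolding has_pd_def by (auto intro!: derivative_eq_intros)
  have "has_pd (\<lambda>y. 1 - inner y y * (1 / R\<^sup>2)) (0 - (inner x x * 0 + (inner x (axis a 1) + inner (axis a 1) x) * (1 / R\<^sup>2))) a x"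
    by (intro has_pd_diff has_pd_mult has_pd_inner has_pd_const ident)
  then have "has_pd (\<lambda>y. 1 - inner y y / R\<^sup>2) (- (2 * x $ a / R\<^sup>2)) a x"
    by (simp add: inner_axis inner_commute)
  from has_pd_compose[OF this max0_power_has_derivative[of m]]
  show ?thesis unfolding bump_def
    by (rule has_pd_eq) (simp add: mult_ac del: of_nat_Suc power_Suc)
qed

lemma sum_sq_comp: "(\<Sum>a\<in>UNIV. (x $ a)\<^sup>2) = inner x (x::real^'n::finite)"
  by (simp add: inner_vec_def power2_eq_square)

text \<open>With b the bump, \<omega> is \<Lambda> b^m where \<Lambda> is of order R^(-2), and the
  weight is b^(m+2). If \<Lambda> is at most \<mu> b^2, then \<omega> is at most \<mu> times the
  weight. Otherwise b^2 is below \<Lambda>/\<mu>, and m = 2n yields b^m at most (\<Lambda>/\<mu>)^n.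
  The resulting constant is of order R^(-2n-2), which beats the volume of the ball.\<close>

lemma bump_cutoff:
  fixes R \<mu> :: real
  assumes R: "R > 0" and \<mu>: "\<mu> > 0"
  defines "m \<equiv> 2 * CARD('n::finite)"
  defines "\<Lambda> \<equiv> 6 * (real (m + 2))\<^sup>2 * real CARD('n) / R\<^sup>2"
  shows "cutoff (\<lambda>x::real^'n. bump R x ^ (m + 2)) (\<lambda>x. \<Lambda> * bump R x ^ m)
     (\<lambda>a x. - (2 * real (m + 2) / R\<^sup>2) * (x $ a * bump R x ^ (m + 1)))
     (\<lambda>a x. - (2 * real (m + 2) / R\<^sup>2) * (bump R x ^ (m + 1)
        - (2 * real (m + 1) / R\<^sup>2) * ((x $ a)\<^sup>2 * bump R x ^ m))) R \<mu> (\<Lambda> * (\<Lambda> / \<mu>) ^ CARD('n))"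
proof
  have \<Lambda>0: "\<Lambda> \<ge> 0" by (simp add: \<Lambda>_def)
  have m2: "m \<ge> 2" by (simp add: m_def Suc_leI)
  have n1: "real CARD('n) \<ge> 1" by (simp add: Suc_leI)
  \<comment> \<open>The squared norm of x is at most \<open>R\<^sup>2\<close> only on the ball; a
    positive exponent is required so that outside it both sides vanish.\<close>
  have loc: "inner x x * bump R x ^ j \<le> R\<^sup>2 * bump R x ^ j" if "j > 0" for x :: "real^'n" and j
  proof (cases "norm x \<ge> R")
    case True
    then show ?thesis using bump_zero[OF R True] that by (simp add: zero_power)
  next
    case False
    then have "inner x x \<le> R\<^sup>2" using power_mono[of "norm x" R 2] by (simp add: dot_square_norm)
    then show ?thesis by (intro mult_right_mono zero_le_power bump_bounds)
  qed
  fix a :: 'n and x :: "real^'n"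
  have ident: "has_pd (\<lambda>y. y) (axis a 1) a x"
    unfolding has_pd_def by (auto intro!: derivative_eq_intros)
  show "has_pd (\<lambda>x. bump R x ^ (m + 2)) (- (2 * real (m + 2) / R\<^sup>2) * (x $ a * bump R x ^ (m + 1))) a x"
    using has_pd_bump_power[of R m x a] by simp
  obtain j where j: "m = Suc j" using m2 by (cases m) auto
  have "has_pd (\<lambda>x. x $ a * bump R x ^ (m + 1))
     (x $ a * (- (2 * real (m + 1) / R\<^sup>2) * (x $ a * bump R x ^ m)) + axis a 1 $ a * bump R x ^ (m + 1)) a x"
    using has_pd_mult[OF has_pd_entry[OF ident, of a] has_pd_bump_power[of R j x a]] by (simp add: j)
  from has_pd_mult[OF has_pd_const[of "- (2 * real (m + 2) / R\<^sup>2)"] this]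
  show "has_pd (\<lambda>x. - (2 * real (m + 2) / R\<^sup>2) * (x $ a * bump R x ^ (m + 1)))
     (- (2 * real (m + 2) / R\<^sup>2) * (bump R x ^ (m + 1) - (2 * real (m + 1) / R\<^sup>2) * ((x $ a)\<^sup>2 * bump R x ^ m))) a x"
    by (rule has_pd_eq) (simp add: algebra_simps power2_eq_square)
  show "continuous_on UNIV (\<lambda>x::real^'n. bump R x ^ (m + 2))"
      "continuous_on UNIV (\<lambda>x::real^'n. - (2 * real (m + 2) / R\<^sup>2) * (x $ a * bump R x ^ (m + 1)))"
      "continuous_on UNIV (\<lambda>x::real^'n. - (2 * real (m + 2) / R\<^sup>2) * (bump R x ^ (m + 1)
        - (2 * real (m + 1) / R\<^sup>2) * ((x $ a)\<^sup>2 * bump R x ^ m)))"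
    by (intro continuous_intros bump_cont)+
  show "bump R x ^ (m + 2) \<ge> 0" "\<Lambda> * bump R x ^ m \<ge> 0" using bump_bounds[of R x] \<Lambda>0 by auto
  show "\<mu> \<ge> 0" "\<Lambda> * (\<Lambda> / \<mu>) ^ CARD('n) \<ge> 0" using \<mu> \<Lambda>0 by auto
  show "(\<Sum>a\<in>UNIV. (- (2 * real (m + 2) / R\<^sup>2) * (x $ a * bump R x ^ (m + 1)))\<^sup>2) \<le> bump R x ^ (m + 2) * (\<Lambda> * bump R x ^ m)"
  proof -
    have sq: "(- (2 * k / R\<^sup>2) * (y * b ^ (m + 1)))\<^sup>2 = (4 * k\<^sup>2 / R^4) * (y\<^sup>2 * b ^ (2 * m + 2))" for k y b :: real
    proof -
      have "(2 * k / R\<^sup>2)\<^sup>2 = 4 * k\<^sup>2 / R^4"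
        by (simp add: power_divide power_mult_distrib power_mult[symmetric])
      moreover have "(b ^ (m + 1))\<^sup>2 = b ^ (2 * m + 2)"
        unfolding power_mult[symmetric] by (rule arg_cong[of _ _ "power b"]) simp
      ultimately show ?thesis by (simp only: power_mult_distrib power2_minus)
    qed
    have "(\<Sum>a\<in>UNIV. (- (2 * real (m + 2) / R\<^sup>2) * (x $ a * bump R x ^ (m + 1)))\<^sup>2)
      = (4 * (real (m + 2))\<^sup>2 / R^4) * (inner x x * bump R x ^ (2 * m + 2))"
      unfolding sum_sq_comp[symmetric] sum_distrib_left sum_distrib_right
      by (intro sum.cong refl sq)
    also have "\<dots> \<le> (4 * (real (m + 2))\<^sup>2 / R^4) * (R\<^sup>2 * bump R x ^ (2 * m + 2))"
      by (intro mult_left_mono loc) auto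
    also have "\<dots> = (4 * (real (m + 2))\<^sup>2 * 1 / R\<^sup>2) * bump R x ^ (2 * m + 2)"
      using R by (simp add: power2_eq_square power4_eq_xxxx)
    also have "\<dots> \<le> \<Lambda> * bump R x ^ (2 * m + 2)"
      unfolding \<Lambda>_def using n1 bump_bounds[of R x] by (intro mult_right_mono divide_right_mono mult_mono) auto
    also have "\<dots> = bump R x ^ (m + 2) * (\<Lambda> * bump R x ^ m)"
      by (simp add: mult_2_right mult_2 power_add)
    finally show ?thesis .
  qed
  show "\<bar>\<Sum>a\<in>UNIV. - (2 * real (m + 2) / R\<^sup>2) * (bump R x ^ (m + 1)
        - (2 * real (m + 1) / R\<^sup>2) * ((x $ a)\<^sup>2 * bump R x ^ m))\<bar> \<le> \<Lambda> * bump R x ^ m"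
  proof -
    have g: "(\<Sum>a\<in>UNIV. - c * (B - d * ((x $ a)\<^sup>2 * P))) = c * (d * ((\<Sum>a\<in>UNIV. (x $ a)\<^sup>2) * P) - real CARD('n) * B)"
      for c d B P :: real
      by (simp add: algebra_simps sum.distrib sum_subtractf sum_distrib_left)
    have e: "(\<Sum>a\<in>UNIV. - (2 * real (m + 2) / R\<^sup>2) * (bump R x ^ (m + 1)
        - (2 * real (m + 1) / R\<^sup>2) * ((x $ a)\<^sup>2 * bump R x ^ m)))
      = (2 * real (m + 2) / R\<^sup>2) * ((2 * real (m + 1) / R\<^sup>2) * (inner x x * bump R x ^ m) - real CARD('n) * bump R x ^ (m + 1))"
      unfolding sum_sq_comp[symmetric] by (rule g)
    have a: "0 \<le> (2 * real (m + 1) / R\<^sup>2) * (inner x x * bump R x ^ m)" using bump_bounds[of R x] by simp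
    have "(2 * real (m + 1) / R\<^sup>2) * (inner x x * bump R x ^ m) \<le> (2 * real (m + 1) / R\<^sup>2) * (R\<^sup>2 * bump R x ^ m)"
      using m2 by (intro mult_left_mono loc) auto
    also have "\<dots> = 2 * real (m + 1) * bump R x ^ m" using R by simp
    finally have b: "(2 * real (m + 1) / R\<^sup>2) * (inner x x * bump R x ^ m) \<le> 2 * real (m + 1) * bump R x ^ m" .
    have c: "0 \<le> real CARD('n) * bump R x ^ (m + 1)" using bump_bounds[of R x] by simp
    have d: "real CARD('n) * bump R x ^ (m + 1) \<le> real CARD('n) * bump R x ^ m"
      using bump_bounds[of R x] by (intro mult_left_mono power_decreasing) auto
    have "\<bar>(2 * real (m + 1) / R\<^sup>2) * (inner x x * bump R x ^ m) - real CARD('n) * bump R x ^ (m + 1)\<bar>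
       \<le> (2 * real (m + 1) + real CARD('n)) * bump R x ^ m"
      using a b c d unfolding distrib_right by linarith
    then have "\<bar>(2 * real (m + 2) / R\<^sup>2) * ((2 * real (m + 1) / R\<^sup>2) * (inner x x * bump R x ^ m) - real CARD('n) * bump R x ^ (m + 1))\<bar>
      \<le> (2 * real (m + 2) / R\<^sup>2) * ((2 * real (m + 1) + real CARD('n)) * bump R x ^ m)"
      unfolding abs_mult by (intro mult_mono) auto
    also have "\<dots> = (2 * real (m + 2) * (2 * real (m + 1) + real CARD('n)) / R\<^sup>2) * bump R x ^ m"
      by simp
    also have "\<dots> \<le> \<Lambda> * bump R x ^ m"
    proof (intro mult_right_mono)
      \<comment> \<open>Source of the 6 in \<open>\<Lambda>\<close>: this sum is at most
        \<open>3 * (m + 2) * n\<close>, and the prefactor of the Laplacian is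
        \<open>2 * (m + 2)\<close>. The gradient bound would only ask for 4.\<close>
      have "2 * real (m + 1) + real CARD('n) \<le> 2 * real (m + 2) * real CARD('n) + 1 * real CARD('n)"
        using n1 mult_mono[of "2 * real (m + 1)" "2 * real (m + 2)" 1 "real CARD('n)"] by simp
      also have "\<dots> \<le> 3 * (real (m + 2) * real CARD('n))" using n1 by (simp add: algebra_simps)
      finally have "2 * real (m + 2) * (2 * real (m + 1) + real CARD('n)) \<le> 2 * real (m + 2) * (3 * (real (m + 2) * real CARD('n)))"
        by (intro mult_left_mono) auto
      moreover have "2 * k * (3 * (k * l)) = 6 * k\<^sup>2 * l" for k l :: real
        by (simp add: power2_eq_square)
      ultimately show "2 * real (m + 2) * (2 * real (m + 1) + real CARD('n)) / R\<^sup>2 \<le> \<Lambda>"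
        unfolding \<Lambda>_def by (metis divide_right_mono zero_le_power2)
    qed (use bump_bounds[of R x] in auto)
    finally show ?thesis unfolding e .
  qed
  show "\<Lambda> * bump R x ^ m \<le> \<mu> * bump R x ^ (m + 2) + \<Lambda> * (\<Lambda> / \<mu>) ^ CARD('n) * indicator (cball 0 R) x"
  proof (cases "norm x \<ge> R")
    case True
    then show ?thesis using bump_zero[OF R True] m2 \<Lambda>0 \<mu> by (simp add: zero_power)
  next
    case False
    then have i: "indicator (cball 0 R) x = (1::real)" by simp
    show ?thesis
    proof (cases "\<Lambda> \<le> \<mu> * (bump R x)\<^sup>2")
      case True
      then have "\<Lambda> * bump R x ^ m \<le> \<mu> * (bump R x)\<^sup>2 * bump R x ^ m"
        using bump_bounds[of R x] by (intro mult_right_mono) auto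
      then show ?thesis using \<Lambda>0 \<mu> unfolding i by (simp add: power_add power2_eq_square mult_ac add_increasing2)
    next
      case False
      then have "(bump R x)\<^sup>2 \<le> \<Lambda> / \<mu>" using \<mu> by (simp add: field_simps)
      then have "((bump R x)\<^sup>2) ^ CARD('n) \<le> (\<Lambda> / \<mu>) ^ CARD('n)" by (intro power_mono) auto
      then have "\<Lambda> * bump R x ^ m \<le> \<Lambda> * (\<Lambda> / \<mu>) ^ CARD('n)"
        using \<Lambda>0 by (intro mult_left_mono) (auto simp: m_def power_mult)
      then show ?thesis using \<mu> bump_bounds[of R x] unfolding i by (simp add: add_increasing)
    qed
  qed
next
  fix x :: "real^'n" and a assume x: "R \<le> norm x"
  then show "bump R x ^ (m + 2) = 0" "- (2 * real (m + 2) / R\<^sup>2) * (x $ a * bump R x ^ (m + 1)) = 0"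
     "- (2 * real (m + 2) / R\<^sup>2) * (bump R x ^ (m + 1) - (2 * real (m + 1) / R\<^sup>2) * ((x $ a)\<^sup>2 * bump R x ^ m)) = 0"
    using bump_zero[OF R x] by (auto simp: m_def)
qed

section \<open>The functions applied to the squared norm\<close>

text \<open>At the squared norm and with q = p/2 this is |h|^p + k |h|^(p+1). The functions
  \<open>ent1\<close> and \<open>ent2\<close> are its first two derivatives for positive
  arguments.\<close>

definition ent :: "real \<Rightarrow> real \<Rightarrow> real \<Rightarrow> real" where
  "ent q k v = v powr q + k * v powr (q + 1/2)"

definition ent1 :: "real \<Rightarrow> real \<Rightarrow> real \<Rightarrow> real" where
  "ent1 q k v = q * v powr (q - 1) + k * ((q + 1/2) * v powr (q - 1/2))"

definition ent2 :: "real \<Rightarrow> real \<Rightarrow> real \<Rightarrow> real" where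
  "ent2 q k v = q * ((q - 1) * v powr (q - 2)) + k * ((q + 1/2) * ((q - 1/2) * v powr (q - 3/2)))"

text \<open>For r at least 1 the factor v^(r-1) dominates a^(r-1). For r below 1 the function is
  concave, and the mean value theorem compares its slope at an intermediate point with the smaller
  slope at v. The constant does not involve a, so \<open>L\<close> stays fixed as \<eta> tends to
  0.\<close>

lemma powr_growth:
  fixes r a v :: real
  assumes r: "r > 0" and a: "0 < a" "a \<le> v"
  shows "r * v powr (r - 1) * (v - a) \<le> max 1 r * (v powr r - a powr r)"
proof (cases "r \<ge> 1")
  case True
  have e: "x powr r = x powr (r - 1) * x" if "x > 0" for x
    using that powr_mult_base[of x "r - 1"] by (simp add: mult.commute)
  have "a powr (r - 1) * a \<le> v powr (r - 1) * a"
    using a True by (intro mult_right_mono powr_mono2) auto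
  then have "v powr (r - 1) * (v - a) \<le> v powr r - a powr r"
    using a e[of a] e[of v] by (simp add: right_diff_distrib)
  then have "r * (v powr (r - 1) * (v - a)) \<le> r * (v powr r - a powr r)"
    using r by (intro mult_left_mono) auto
  then show ?thesis using True by (simp add: max_def mult.assoc)
next
  case False
  show ?thesis
  proof (cases "a = v")
    case True
    then show ?thesis by simp
  next
    case ne: False
    then have "\<exists>z>a. z < v \<and> v powr r - a powr r = (v - a) * (r * z powr (r - 1))"
      using a by (intro MVT2) (auto intro!: has_real_derivative_powr)
    then obtain z where z: "a < z" "z < v" "v powr r - a powr r = (v - a) * (r * z powr (r - 1))" by blast
    have "v powr (r - 1) \<le> z powr (r - 1)"
      using z a False by (intro powr_mono2') auto
    then have "(v - a) * (r * v powr (r - 1)) \<le> (v - a) * (r * z powr (r - 1))"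
      using r a by (intro mult_left_mono) auto
    then show ?thesis using z False by (simp add: max_def mult_ac)
  qed
qed

lemma ent_mono: "0 \<le> a \<Longrightarrow> a \<le> b \<Longrightarrow> q > 0 \<Longrightarrow> k \<ge> 0 \<Longrightarrow> ent q k a \<le> ent q k b"
  unfolding ent_def by (intro add_mono mult_left_mono powr_mono2) auto

lemma ent_nonneg: "k \<ge> 0 \<Longrightarrow> ent q k a \<ge> 0"
  unfolding ent_def by simp

text \<open>Put c = 9 D n. For q at least 1 the function is convex, and c sqrt v at most 1 suffices.
  For q < 1 the concavity of v^q costs 4 q (1 - q) v^(q-1). Since 1 - q is at most 1/2, this is at
  most 2 q v^(q-1), with equality at q = 1/2, where nothing of that term is left over. The further
  loss c q v^(q-1/2) is paid by the term with k, which is convex because q + 1/2 is at least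
  1.\<close>

lemma (in small_ricci_deturck) entropy_ent:
  assumes \<eta>: "\<eta> > 0" and V: "9 * D * CARD('n) * sqrt V \<le> 1"
    and h: "\<And>x t. t \<ge> 0 \<Longrightarrow> inner (h x t) (h x t) + \<eta> \<le> V"
    and qk: "1 \<le> q \<and> k = 0 \<or> 1/2 \<le> q \<and> q < 1 \<and> k = 18 * D * CARD('n)"
  shows "entropy h C K (ent q k) (ent1 q k) (ent2 q k) \<eta> V (q + 1)"
proof
  have q: "q \<ge> 1/2" and k: "k \<ge> 0" using qk D_bounds by auto
  show "\<eta> > 0" "0 \<le> q + 1" "9 * D * CARD('n) * sqrt V \<le> 1" using \<eta> V q by auto
  show "inner (h x t) (h x t) + \<eta> \<le> V" if "t \<ge> 0" for x t using h that .
  have e1: "q - 1 - 1 = q - 2" "q - 1/2 - 1 = q - 3/2" "q + 1/2 - 1 = q - 1/2" by auto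
  fix v :: real
  show "(ent q k has_real_derivative ent1 q k v) (at v)" if "v > 0"
  proof -
    have "((\<lambda>v. v powr q + k * v powr (q + 1/2)) has_real_derivative q * v powr (q - 1) + k * ((q + 1/2) * v powr (q + 1/2 - 1))) (at v)"
      using that by (intro DERIV_add DERIV_cmult has_real_derivative_powr)
    then show ?thesis unfolding e1 ent_def[abs_def] ent1_def .
  qed
  show "(ent1 q k has_real_derivative ent2 q k v) (at v)" if "v > 0"
  proof -
    have "((\<lambda>v. q * v powr (q - 1) + k * ((q + 1/2) * v powr (q - 1/2))) has_real_derivative
      q * ((q - 1) * v powr (q - 1 - 1)) + k * ((q + 1/2) * ((q - 1/2) * v powr (q - 1/2 - 1)))) (at v)"
      using that by (intro DERIV_add DERIV_cmult has_real_derivative_powr)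
    then show ?thesis unfolding e1 ent1_def[abs_def] ent2_def .
  qed
  show "continuous_on {0<..} (ent2 q k)"
    unfolding ent2_def[abs_def] by (intro continuous_intros) auto
  have n: "ent1 q k v \<ge> 0" for v
    unfolding ent1_def using q k by (intro add_nonneg_nonneg mult_nonneg_nonneg) auto
  then show "ent1 q k v \<ge> 0" .
  show "ent1 q k v * (v - \<eta>) \<le> (q + 1) * (ent q k v - ent q k \<eta>)" if "\<eta> \<le> v" "v \<le> V"
  proof -
    have a: "q * v powr (q - 1) * (v - \<eta>) \<le> (q + 1) * (v powr q - \<eta> powr q)"
    proof -
      have "max 1 q * (v powr q - \<eta> powr q) \<le> (q + 1) * (v powr q - \<eta> powr q)"
        using q \<eta> that by (intro mult_right_mono) (auto intro!: powr_mono2)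
      then show ?thesis using powr_growth[of q \<eta> v] q \<eta> that by simp
    qed
    have b: "(q + 1/2) * v powr (q - 1/2) * (v - \<eta>) \<le> (q + 1) * (v powr (q + 1/2) - \<eta> powr (q + 1/2))"
    proof -
      have "max 1 (q + 1/2) * (v powr (q + 1/2) - \<eta> powr (q + 1/2)) \<le> (q + 1) * (v powr (q + 1/2) - \<eta> powr (q + 1/2))"
        using q \<eta> that by (intro mult_right_mono) (auto intro!: powr_mono2)
      moreover have "(q + 1/2) * v powr (q + 1/2 - 1) * (v - \<eta>) \<le> max 1 (q + 1/2) * (v powr (q + 1/2) - \<eta> powr (q + 1/2))"
        using q \<eta> that by (intro powr_growth) auto
      ultimately show ?thesis unfolding e1 by linarith
    qed
    show ?thesis using add_mono[OF a mult_left_mono[OF b k]]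
      unfolding ent_def ent1_def by (simp add: algebra_simps)
  qed
  show "4 * v * max 0 (- ent2 q k v) \<le> 2 * ent1 q k v - 9 * D * CARD('n) * ent1 q k v * sqrt v" if v: "0 < v" "v \<le> V"
  proof -
    define c where "c = 9 * D * real CARD('n)"
    have c0: "c \<ge> 0" using D_bounds by (simp add: c_def)
    define s where "s = sqrt v"
    have s0: "s > 0" using v by (simp add: s_def)
    have cs: "c * s \<le> 1"
    proof -
      have "c * s \<le> c * sqrt V" unfolding s_def using v c0 by (intro mult_left_mono) auto
      then show ?thesis using V by (simp add: c_def)
    qed
    show ?thesis
    proof (cases "q \<ge> 1")
      case True
      then have k0: "k = 0" using qk by auto
      have "ent2 q k v \<ge> 0" using True by (simp add: ent2_def k0)
      moreover have "c * s * ent1 q k v \<le> 1 * ent1 q k v" using cs n by (intro mult_right_mono) auto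
      ultimately show ?thesis using n[of v] by (simp add: c_def s_def max_def mult_ac)
    next
      case False
      then have q1: "q < 1" and kc: "k = 2 * c" using qk by (auto simp: c_def)
      define a where "a = v powr (q - 1)"
      have a0: "a > 0" using v by (simp add: a_def)
      have as: "v powr (q - 1/2) = a * s"
        using v by (simp add: a_def s_def powr_half_sqrt[symmetric] powr_add[symmetric])
      have av: "v * v powr (q - 2) = a"
        using v powr_mult_base[of v "q - 2"] by (simp add: a_def)
      have "- ent2 q k v \<le> q * (1 - q) * v powr (q - 2)"
      proof -
        have "0 \<le> k * ((q + 1/2) * ((q - 1/2) * v powr (q - 3/2)))"
          using q k by (intro mult_nonneg_nonneg) auto
        moreover have "q * ((q - 1) * v powr (q - 2)) = - (q * (1 - q) * v powr (q - 2))"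
          by (simp add: algebra_simps)
        ultimately show ?thesis unfolding ent2_def by linarith
      qed
      then have "max 0 (- ent2 q k v) \<le> q * (1 - q) * v powr (q - 2)"
        using q q1 by simp
      then have "4 * v * max 0 (- ent2 q k v) \<le> 4 * v * (q * (1 - q) * v powr (q - 2))"
        using v by (intro mult_left_mono) auto
      also have "\<dots> = 4 * q * (1 - q) * (v * v powr (q - 2))" by (simp add: mult_ac)
      also have "\<dots> = (4 * q * a) * (1 - q)" unfolding av by (simp add: mult_ac)
      also have "\<dots> \<le> (4 * q * a) * (1/2)"
        using q a0 by (intro mult_left_mono) auto
      finally have 1: "4 * v * max 0 (- ent2 q k v) \<le> 2 * (q * a)" by simp
      \<comment> \<open>The term with \<open>k\<close> enters twice the first derivative two times.
        One copy pays for its own loss here, the other covers the loss \<open>c * q * a * s\<close>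
        of the leading power.\<close>
      have 2: "c * s * (k * ((q + 1/2) * (a * s))) \<le> 1 * (k * ((q + 1/2) * (a * s)))"
        using cs k q a0 s0 by (intro mult_right_mono) auto
      have "k * (q + 1/2) \<ge> c * q"
        using mult_right_mono[of c "2 * c" "q + 1/2"] mult_left_mono[of q "q + 1/2" c] c0 q
        unfolding kc by linarith
      then have 3: "(k * (q + 1/2)) * (a * s) \<ge> (c * q) * (a * s)"
        using a0 s0 by (intro mult_right_mono) auto
      have e: "ent1 q k v = q * a + k * ((q + 1/2) * (a * s))"
        unfolding ent1_def as a_def ..
      have "2 * (q * a) \<le> 2 * ent1 q k v - c * s * ent1 q k v"
        using 2 3 unfolding e by (simp add: algebra_simps)
      then show ?thesis using 1 by (simp add: c_def s_def mult_ac)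
    qed
  qed
qed

section \<open>Removing the weight\<close>

context small_ricci_deturck
begin

definition E :: "real \<Rightarrow> real \<Rightarrow> real^'n \<Rightarrow> real \<Rightarrow> real" where
  "E q k x t = ent q k (inner (h x t) (h x t))"

text \<open>The constant \<kappa> that \<open>bump_cutoff\<close> supplies, as a function of radius
  and \<mu>.\<close>

definition bump_rate :: "real \<Rightarrow> real \<Rightarrow> real" where
  "bump_rate R \<mu> = (let \<Lambda> = 6 * (real (2 * CARD('n) + 2))\<^sup>2 * real CARD('n) / R\<^sup>2 in \<Lambda> * (\<Lambda> / \<mu>) ^ CARD('n))"

abbreviation wt :: "real \<Rightarrow> real^'n \<Rightarrow> real" where
  "wt R x \<equiv> bump R x ^ (2 * CARD('n) + 2)"

lemma wt_bounds: "0 \<le> wt R x" "wt R x \<le> 1"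
  using bump_bounds[of R x] by (auto intro!: power_le_one simp del: power_Suc)

lemma cont_E:
  assumes "t \<ge> 0" "q > 0" shows "continuous_on UNIV (\<lambda>x. E q k x t)"
  unfolding E_def ent_def using assms
  by (intro continuous_intros continuous_on_powr' cont_h) auto

text \<open>\<open>ent q k \<eta>\<close> is dropped from the error term, so that the error no
  longer depends on \<open>\<eta>\<close> when \<open>\<eta>\<close> tends to 0.\<close>

lemma regularized_mass_le:
  assumes \<eta>: "\<eta> > 0" and V: "9 * D * CARD('n) * sqrt V \<le> 1"
    and h: "\<And>x t. t \<ge> 0 \<Longrightarrow> inner (h x t) (h x t) + \<eta> \<le> V"
    and qk: "1 \<le> q \<and> k = 0 \<or> 1/2 \<le> q \<and> q < 1 \<and> k = 18 * D * CARD('n)"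
    and R: "R > 0" and \<mu>: "\<mu> > 0" and t: "t \<ge> 0"
  shows "(\<integral>x. wt R x * (ent q k (inner (h x t) (h x t) + \<eta>) - ent q k \<eta>) \<partial>lborel)
    \<le> exp ((q + 2) * \<mu> * t) * ((\<integral>x. wt R x * (ent q k (inner (h x 0) (h x 0) + \<eta>) - ent q k \<eta>) \<partial>lborel)
      + (q + 2) * (bump_rate R \<mu> * ent q k V * measure lborel (cball (0::real^'n) R)) * t)"
proof -
  interpret entropy h C K "ent q k" "ent1 q k" "ent2 q k" \<eta> V "q + 1"
    by (rule entropy_ent[OF \<eta> V h qk])
  note w = weighted_entropy.intro[OF entropy_axioms bump_cutoff[OF R \<mu>]]
  have k0: "k \<ge> 0" using qk D_bounds by auto
  have q0: "q + 2 \<ge> 0" using qk by auto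
  have r0: "bump_rate R \<mu> \<ge> 0" using \<mu> by (simp add: bump_rate_def Let_def)
  have P: "bump_rate R \<mu> * (ent q k V - ent q k \<eta>) * measure lborel (cball (0::real^'n) R)
     \<le> bump_rate R \<mu> * ent q k V * measure lborel (cball (0::real^'n) R)"
    using r0 ent_nonneg[OF k0, of q \<eta>] by (intro mult_right_mono mult_left_mono) auto
  have "exp ((q + 2) * \<mu> * t) * ((\<integral>x. wt R x * (ent q k (inner (h x 0) (h x 0) + \<eta>) - ent q k \<eta>) \<partial>lborel)
      + (q + 2) * (bump_rate R \<mu> * (ent q k V - ent q k \<eta>) * measure lborel (cball (0::real^'n) R)) * t)
    \<le> exp ((q + 2) * \<mu> * t) * ((\<integral>x. wt R x * (ent q k (inner (h x 0) (h x 0) + \<eta>) - ent q k \<eta>) \<partial>lborel)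
      + (q + 2) * (bump_rate R \<mu> * ent q k V * measure lborel (cball (0::real^'n) R)) * t)"
    by (intro mult_left_mono[OF add_left_mono[OF mult_right_mono[OF mult_left_mono[OF P q0] t]]]) simp
  moreover have q2: "1 + (q + 1) = q + 2" by simp
  have "(\<integral>x. wt R x * (ent q k (inner (h x t) (h x t) + \<eta>) - ent q k \<eta>) \<partial>lborel)
    \<le> exp ((q + 2) * \<mu> * t) * ((\<integral>x. wt R x * (ent q k (inner (h x 0) (h x 0) + \<eta>) - ent q k \<eta>) \<partial>lborel)
      + (q + 2) * (bump_rate R \<mu> * (ent q k V - ent q k \<eta>) * measure lborel (cball (0::real^'n) R)) * t)"
    using weighted_entropy.mass_le[OF w t]
    unfolding weighted_entropy.mass_def[OF w] F_def v_def bump_rate_def Let_def q2 .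
  ultimately show ?thesis by (rule order.trans[rotated])
qed

text \<open>Dominated convergence for \<eta> tending to 0 at a fixed weight; the weight times
  \<open>ent q k V\<close> is an integrable majorant.\<close>

lemma mass_le:
  assumes V: "9 * D * CARD('n) * sqrt V \<le> 1"
    and h: "\<And>x t. t \<ge> 0 \<Longrightarrow> norm (h x t) \<le> M" and M: "M \<ge> 0" "M\<^sup>2 < V"
    and qk: "1 \<le> q \<and> k = 0 \<or> 1/2 \<le> q \<and> q < 1 \<and> k = 18 * D * CARD('n)"
    and R: "R > 0" and \<mu>: "\<mu> > 0" and t: "t \<ge> 0"
  shows "(\<integral>x. wt R x * E q k x t \<partial>lborel)
    \<le> exp ((q + 2) * \<mu> * t) * ((\<integral>x. wt R x * E q k x 0 \<partial>lborel)
      + (q + 2) * (bump_rate R \<mu> * ent q k V * measure lborel (cball (0::real^'n) R)) * t)"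
proof -
  have q: "q > 0" and k: "k \<ge> 0" using qk D_bounds by auto
  \<comment> \<open>The strict gap between \<open>M\<^sup>2\<close> and \<open>V\<close> leaves room
    for a positive regularisation with squared norm plus \<open>\<eta> j\<close> still at most
    \<open>V\<close>.\<close>
  define \<eta> where "\<eta> j = (V - M\<^sup>2) * inverse (real (Suc j))" for j
  have \<eta>: "\<eta> j > 0" "\<eta> j \<le> V - M\<^sup>2" for j
  proof -
    show "\<eta> j > 0" using M by (simp add: \<eta>_def)
    have "(V - M\<^sup>2) * inverse (real (Suc j)) \<le> (V - M\<^sup>2) * 1"
      using M by (intro mult_left_mono) (auto simp: inverse_le_1_iff)
    then show "\<eta> j \<le> V - M\<^sup>2" by (simp add: \<eta>_def)
  qed
  have "\<eta> \<longlonglongrightarrow> (V - M\<^sup>2) * 0"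
    unfolding \<eta>_def by (intro tendsto_mult tendsto_const LIMSEQ_inverse_real_of_nat)
  then have \<eta>0: "\<eta> \<longlonglongrightarrow> 0" by simp
  have hM: "inner (h x s) (h x s) \<le> M\<^sup>2" if "s \<ge> 0" for x s
    using power_mono[OF h[OF that, of x], of 2] by (simp add: dot_square_norm)
  have hV: "inner (h x s) (h x s) + \<eta> j \<le> V" if "s \<ge> 0" for x s j
    using hM[OF that, of x] \<eta>(2)[of j] by linarith
  obtain a b :: "real^'n" where ab: "cball 0 R \<subseteq> cbox a b"
    using bounded_cball bounded_subset_cbox_symmetric by blast
  have wt0: "wt R x = 0" if "x \<notin> cbox a b" for x
    using bump_zero[OF R, of x] ab that by (force simp: subset_eq)
  have cwt: "continuous_on UNIV (wt R)" by (intro continuous_intros bump_cont)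
  have lim: "(\<lambda>j. \<integral>x. wt R x * (ent q k (inner (h x s) (h x s) + \<eta> j) - ent q k (\<eta> j)) \<partial>lborel)
     \<longlonglongrightarrow> (\<integral>x. wt R x * E q k x s \<partial>lborel)" if s: "s \<ge> 0" for s
  proof (rule integral_dominated_convergence[where w="\<lambda>x. wt R x * ent q k V"])
    have "continuous_on UNIV (\<lambda>x. wt R x * (ent q k (inner (h x s) (h x s) + \<eta> j) - ent q k (\<eta> j)))" for j
      unfolding ent_def using q \<eta>(1)[of j]
      by (intro continuous_intros cwt cont_h s continuous_on_powr') (auto intro: add_nonneg_nonneg less_imp_le)
    then show "(\<lambda>x. wt R x * (ent q k (inner (h x s) (h x s) + \<eta> j) - ent q k (\<eta> j))) \<in> borel_measurable lborel" for j
      using borel_measurable_continuous_onI by auto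
    have "continuous_on UNIV (\<lambda>x. wt R x * E q k x s)" by (intro continuous_intros cwt cont_E s q)
    then show "(\<lambda>x. wt R x * E q k x s) \<in> borel_measurable lborel"
      using borel_measurable_continuous_onI by auto
    show "integrable lborel (\<lambda>x. wt R x * ent q k V)"
      by (rule continuous_compact_support(1)[of _ a b]) (use wt0 in \<open>auto intro!: continuous_intros bump_cont\<close>)
    show "AE x in lborel. (\<lambda>j. wt R x * (ent q k (inner (h x s) (h x s) + \<eta> j) - ent q k (\<eta> j))) \<longlonglongrightarrow> wt R x * E q k x s"
    proof (intro AE_I2)
      fix x
      have c: "(\<lambda>j. ent q k (u + \<eta> j)) \<longlonglongrightarrow> ent q k (u + 0)" if "u \<ge> 0" for u
        unfolding ent_def
        by (intro tendsto_intros \<eta>0) (use q that \<eta>(1) in \<open>auto intro!: always_eventually add_nonneg_nonneg less_imp_le\<close>)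
      have "(\<lambda>j. wt R x * (ent q k (inner (h x s) (h x s) + \<eta> j) - ent q k (0 + \<eta> j)))
         \<longlonglongrightarrow> wt R x * (ent q k (inner (h x s) (h x s) + 0) - ent q k (0 + 0))"
        by (intro tendsto_mult tendsto_diff tendsto_const c) auto
      then show "(\<lambda>j. wt R x * (ent q k (inner (h x s) (h x s) + \<eta> j) - ent q k (\<eta> j))) \<longlonglongrightarrow> wt R x * E q k x s"
        by (simp add: E_def ent_def)
    qed
    show "AE x in lborel. norm (wt R x * (ent q k (inner (h x s) (h x s) + \<eta> j) - ent q k (\<eta> j))) \<le> wt R x * ent q k V" for j
    proof (intro AE_I2)
      fix x
      have "ent q k (\<eta> j) \<le> ent q k (inner (h x s) (h x s) + \<eta> j)"
        using \<eta>(1)[of j] q k by (intro ent_mono) auto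
      moreover have "ent q k (inner (h x s) (h x s) + \<eta> j) \<le> ent q k V"
        using \<eta>(1)[of j] q k hV[OF s, of x j] by (intro ent_mono) (auto intro: add_nonneg_nonneg less_imp_le)
      ultimately have "\<bar>ent q k (inner (h x s) (h x s) + \<eta> j) - ent q k (\<eta> j)\<bar> \<le> ent q k V"
        using ent_nonneg[OF k, of q "\<eta> j"] by linarith
      then show "norm (wt R x * (ent q k (inner (h x s) (h x s) + \<eta> j) - ent q k (\<eta> j))) \<le> wt R x * ent q k V"
        using wt_bounds(1)[of R x] unfolding real_norm_def abs_mult by (simp only: abs_of_nonneg mult_left_mono)
    qed
  qed
  show ?thesis
  proof (rule LIMSEQ_le[OF lim[OF t]])
    show "(\<lambda>j. exp ((q + 2) * \<mu> * t) * ((\<integral>x. wt R x * (ent q k (inner (h x 0) (h x 0) + \<eta> j) - ent q k (\<eta> j)) \<partial>lborel)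
      + (q + 2) * (bump_rate R \<mu> * ent q k V * measure lborel (cball (0::real^'n) R)) * t))
      \<longlonglongrightarrow> exp ((q + 2) * \<mu> * t) * ((\<integral>x. wt R x * E q k x 0 \<partial>lborel)
      + (q + 2) * (bump_rate R \<mu> * ent q k V * measure lborel (cball (0::real^'n) R)) * t)"
      by (intro tendsto_mult tendsto_add tendsto_const lim) simp
  qed (use regularized_mass_le[OF \<eta>(1) V hV qk R \<mu> t] in blast)
qed

text \<open>\<open>bump_rate\<close> is of order R^(-2n-2) for fixed \<mu> and the volume of order
  R^n, so the product decays like R^(-n-2).\<close>

lemma bump_rate_volume_tendsto:
  assumes "\<mu> > 0"
  shows "(\<lambda>j. bump_rate (real (Suc j)) \<mu> * measure lborel (cball (0::real^'n) (real (Suc j)))) \<longlonglongrightarrow> 0"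
proof -
  define c where "c = 6 * (real (2 * CARD('n) + 2))\<^sup>2 * real CARD('n)"
  define N where "N = CARD('n)"
  define A where "A = c * (c / \<mu>) ^ N * unit_ball_vol (real CARD('n))"
  have "bump_rate R \<mu> * measure lborel (cball (0::real^'n) R) = A * inverse R ^ (N + 2)" if R: "R > 0" for R
  proof -
    have 1: "c / R\<^sup>2 = c * (inverse R)\<^sup>2" "c / R\<^sup>2 / \<mu> = (c / \<mu>) * (inverse R)\<^sup>2"
      by (simp_all add: divide_inverse power_inverse mult_ac)
    have "inverse R ^ N * R ^ N = 1" using R by (simp add: power_mult_distrib[symmetric])
    then have 2: "((inverse R)\<^sup>2) ^ N * R ^ N = inverse R ^ N"
      by (simp add: power_mult[symmetric] mult_2 power_add mult.assoc)
    have br: "bump_rate R \<mu> = c / R\<^sup>2 * (c / R\<^sup>2 / \<mu>) ^ N"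
      by (simp only: bump_rate_def Let_def c_def N_def)
    have vol: "measure lborel (cball (0::real^'n) R) = unit_ball_vol (real CARD('n)) * R ^ N"
      using R content_cball[of R "0::real^'n"] by (simp add: N_def)
    have "bump_rate R \<mu> * measure lborel (cball (0::real^'n) R)
      = A * ((inverse R)\<^sup>2 * (((inverse R)\<^sup>2) ^ N * R ^ N))"
      unfolding br unfolding 1(2) unfolding 1(1) vol A_def N_def[symmetric] power_mult_distrib
      by (simp only: mult_ac)
    then show ?thesis unfolding 2 by (simp only: power_add mult_ac)
  qed
  then have "(\<lambda>j. bump_rate (real (Suc j)) \<mu> * measure lborel (cball (0::real^'n) (real (Suc j))))
     = (\<lambda>j. A * inverse (real (Suc j)) ^ (N + 2))" by (simp del: of_nat_Suc)
  moreover have "(\<lambda>j. A * inverse (real (Suc j)) ^ (N + 2)) \<longlonglongrightarrow> A * 0 ^ (N + 2)"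
    by (intro tendsto_mult tendsto_const tendsto_power LIMSEQ_inverse_real_of_nat)
  ultimately show ?thesis by simp
qed

lemma wt_tendsto: "(\<lambda>j. wt (real (Suc j)) x) \<longlonglongrightarrow> 1"
proof -
  have "(\<lambda>j. max 0 (1 - inner x x * (inverse (real (Suc j)))\<^sup>2) ^ (2 * CARD('n) + 2)) \<longlonglongrightarrow> max 0 (1 - inner x x * 0\<^sup>2) ^ (2 * CARD('n) + 2)"
    by (intro tendsto_power tendsto_max tendsto_diff tendsto_mult tendsto_const LIMSEQ_inverse_real_of_nat)
  then show ?thesis by (simp add: bump_def divide_inverse power_inverse del: of_nat_Suc)
qed

text \<open>Integrability at time t is not yet known, so the left-hand side is a nonnegative
  integral. Fatou's lemma along growing radii gives the bound up to the factor
  \<open>exp ((q + 2) * \<mu> * t)\<close>.\<close>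

lemma nn_integral_E_le:
  assumes V: "9 * D * CARD('n) * sqrt V \<le> 1"
    and h: "\<And>x t. t \<ge> 0 \<Longrightarrow> norm (h x t) \<le> M" and M: "M \<ge> 0" "M\<^sup>2 < V"
    and qk: "1 \<le> q \<and> k = 0 \<or> 1/2 \<le> q \<and> q < 1 \<and> k = 18 * D * CARD('n)"
    and t: "t \<ge> 0" and i0: "integrable lborel (\<lambda>x. E q k x 0)"
  shows "(\<integral>\<^sup>+x. ennreal (E q k x t) \<partial>lborel) \<le> ennreal (\<integral>x. E q k x 0 \<partial>lborel)"
proof -
  have q: "q > 0" and k: "k \<ge> 0" using qk D_bounds by auto
  have E0: "E q k x s \<ge> 0" for x s unfolding E_def by (rule ent_nonneg[OF k])
  have step: "(\<integral>\<^sup>+x. ennreal (E q k x t) \<partial>lborel) \<le> ennreal (exp ((q + 2) * \<mu> * t) * (\<integral>x. E q k x 0 \<partial>lborel))"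
    if \<mu>: "\<mu> > 0" for \<mu>
  proof -
    define \<delta> where "\<delta> j = (q + 2) * (bump_rate (real (Suc j)) \<mu> * ent q k V * measure lborel (cball (0::real^'n) (real (Suc j)))) * t" for j
    have \<delta>: "\<delta> \<longlonglongrightarrow> 0"
    proof -
      have "(\<lambda>j. (q + 2) * ent q k V * t * (bump_rate (real (Suc j)) \<mu> * measure lborel (cball (0::real^'n) (real (Suc j))))) \<longlonglongrightarrow> (q + 2) * ent q k V * t * 0"
        by (intro tendsto_mult tendsto_const bump_rate_volume_tendsto \<mu>)
      then show ?thesis unfolding \<delta>_def by (simp add: mult_ac del: of_nat_Suc)
    qed
    have cw: "continuous_on UNIV (\<lambda>x. wt R x * E q k x s)" if "s \<ge> 0" for R s
      by (intro continuous_intros bump_cont cont_E that q)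
    have iw: "integrable lborel (\<lambda>x. wt R x * E q k x s)" if "s \<ge> 0" "R > 0" for R s
    proof -
      obtain a b :: "real^'n" where ab: "cball 0 R \<subseteq> cbox a b"
        using bounded_cball bounded_subset_cbox_symmetric by blast
      have "wt R x = 0" if "x \<notin> cbox a b" for x
        using bump_zero[OF \<open>R > 0\<close>, of x] ab that by (force simp: subset_eq)
      then show ?thesis by (intro continuous_compact_support(1)[OF cw[OF \<open>s \<ge> 0\<close>], of a b]) simp
    qed
    have b: "(\<integral>\<^sup>+x. ennreal (wt (real (Suc j)) x * E q k x t) \<partial>lborel)
      \<le> ennreal (exp ((q + 2) * \<mu> * t) * ((\<integral>x. E q k x 0 \<partial>lborel) + \<delta> j))" for j
    proof -
      have "(\<integral>x. wt (real (Suc j)) x * E q k x 0 \<partial>lborel) \<le> (\<integral>x. E q k x 0 \<partial>lborel)"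
        using wt_bounds E0 by (intro integral_mono iw i0 mult_left_le_one_le) auto
      then have "(\<integral>x. wt (real (Suc j)) x * E q k x t \<partial>lborel) \<le> exp ((q + 2) * \<mu> * t) * ((\<integral>x. E q k x 0 \<partial>lborel) + \<delta> j)"
        unfolding \<delta>_def by (intro order.trans[OF mass_le[OF V h M qk _ \<mu> t]] mult_left_mono add_right_mono) auto
      moreover have "(\<integral>\<^sup>+x. ennreal (wt (real (Suc j)) x * E q k x t) \<partial>lborel) = ennreal (\<integral>x. wt (real (Suc j)) x * E q k x t \<partial>lborel)"
        using wt_bounds E0 by (intro nn_integral_eq_integral iw t AE_I2 mult_nonneg_nonneg) auto
      ultimately show ?thesis by (simp add: ennreal_leI del: of_nat_Suc)
    qed
    have meas: "(\<lambda>x. wt (real (Suc j)) x * E q k x t) \<in> borel_measurable lborel" for j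
      using borel_measurable_continuous_onI[OF cw[OF t], of "real (Suc j)"] by auto
    have "(\<integral>\<^sup>+x. ennreal (E q k x t) \<partial>lborel) = (\<integral>\<^sup>+x. liminf (\<lambda>j. ennreal (wt (real (Suc j)) x * E q k x t)) \<partial>lborel)"
    proof (intro nn_integral_cong)
      fix x
      have "(\<lambda>j. ennreal (wt (real (Suc j)) x * E q k x t)) \<longlonglongrightarrow> ennreal (1 * E q k x t)"
        by (intro tendsto_ennrealI tendsto_mult wt_tendsto tendsto_const)
      then show "ennreal (E q k x t) = liminf (\<lambda>j. ennreal (wt (real (Suc j)) x * E q k x t))"
        by (simp add: lim_imp_Liminf del: of_nat_Suc)
    qed
    also have "\<dots> \<le> liminf (\<lambda>j. \<integral>\<^sup>+x. ennreal (wt (real (Suc j)) x * E q k x t) \<partial>lborel)"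
      by (intro nn_integral_liminf measurable_compose[OF _ measurable_ennreal]) (rule meas)
    also have "\<dots> \<le> liminf (\<lambda>j. ennreal (exp ((q + 2) * \<mu> * t) * ((\<integral>x. E q k x 0 \<partial>lborel) + \<delta> j)))"
      by (intro Liminf_mono always_eventually allI b)
    also have "\<dots> = ennreal (exp ((q + 2) * \<mu> * t) * ((\<integral>x. E q k x 0 \<partial>lborel) + 0))"
      by (intro lim_imp_Liminf tendsto_ennrealI tendsto_mult tendsto_add tendsto_const \<delta>) simp
    finally show ?thesis by simp
  qed
  \<comment> \<open>\<open>\<mu>\<close> tends to 0 only after the radius has gone to infinity,
    since \<open>bump_rate\<close> contains a negative power of \<open>\<mu>\<close>.\<close>
  have "(\<lambda>j. ennreal (exp ((q + 2) * inverse (real (Suc j)) * t) * (\<integral>x. E q k x 0 \<partial>lborel)))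
     \<longlonglongrightarrow> ennreal (exp ((q + 2) * 0 * t) * (\<integral>x. E q k x 0 \<partial>lborel))"
    by (intro tendsto_ennrealI tendsto_mult tendsto_exp tendsto_const LIMSEQ_inverse_real_of_nat)
  then have "(\<integral>\<^sup>+x. ennreal (E q k x t) \<partial>lborel) \<le> ennreal (exp ((q + 2) * 0 * t) * (\<integral>x. E q k x 0 \<partial>lborel))"
    by (rule LIMSEQ_le_const) (use step in \<open>auto simp del: of_nat_Suc\<close>)
  then show ?thesis by simp
qed

end

section \<open>From the integral bound to the L^p norms, and the choice of constants\<close>

lemma (in small_ricci_deturck) Lp_bound:
  assumes e: "9 * D * CARD('n) * e = 1" and M: "M \<ge> 0" "M < e"
    and h: "\<And>x t. t \<ge> 0 \<Longrightarrow> norm (h x t) \<le> M"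
    and p: "p \<ge> 1" and L0: "Lp_finite p (\<lambda>x. h x 0)" and t: "t \<ge> 0"
    and B: "p \<ge> 2 \<and> B = 1 \<or> p < 2 \<and> B = 3"
  shows "Lp_finite p (\<lambda>x. h x t) \<and> Lp_norm p (\<lambda>x. h x t) \<le> B * Lp_norm p (\<lambda>x. h x 0)"
proof -
  define k where "k = (if p \<ge> 2 then 0 else 18 * D * CARD('n))"
  have qk: "1 \<le> p / 2 \<and> k = 0 \<or> 1/2 \<le> p / 2 \<and> p / 2 < 1 \<and> k = 18 * D * CARD('n)"
    using p by (auto simp: k_def)
  have k0: "k \<ge> 0" using D_bounds by (simp add: k_def)
  \<comment> \<open>For p < 2 the choice of \<open>k\<close> and the normalisation of
    \<open>e\<close> give \<open>k * e = 2\<close>, hence the factor 3; for p at least 2 there is no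
    extra term.\<close>
  have ke: "1 + k * e = B" using B e by (auto simp: k_def mult_ac)
  have B1: "B \<ge> 1" using B by auto
  have sq: "(inner X X) powr r = norm X powr (2 * r)" for X :: "real^'n^'n" and r
    by (simp add: dot_square_norm powr_powr[symmetric] flip: powr_numeral)
  have E_eq: "E (p / 2) k x s = norm (h x s) powr p * (1 + k * norm (h x s))" for x s
  proof -
    have "2 * (p / 2 + 1/2) = p + 1" "2 * (p / 2) = p" by auto
    then show ?thesis
      unfolding E_def ent_def sq by (simp add: powr_add algebra_simps)
  qed
  have E_lower: "norm (h x s) powr p \<le> E (p / 2) k x s" for x s
    unfolding E_eq using k0 mult_left_mono[of 1 "1 + k * norm (h x s)" "norm (h x s) powr p"] by simp
  have E_upper: "E (p / 2) k x s \<le> B * norm (h x s) powr p" if "s \<ge> 0" for x s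
  proof -
    have "k * norm (h x s) \<le> k * e" using h[OF that, of x] M k0 by (intro mult_left_mono) auto
    then have "norm (h x s) powr p * (1 + k * norm (h x s)) \<le> norm (h x s) powr p * B"
      unfolding ke[symmetric] by (intro mult_left_mono) auto
    then show ?thesis unfolding E_eq by (simp add: mult.commute)
  qed
  have meas_h: "(\<lambda>x. h x s) \<in> borel_measurable lborel" if "s \<ge> 0" for s
    using borel_measurable_continuous_onI[OF cont_h[OF that]] by simp
  have i0: "integrable lborel (\<lambda>x. norm (h x 0) powr p)" using L0 by (simp add: Lp_finite_def)
  have iE: "integrable lborel (\<lambda>x. E (p / 2) k x 0)"
  proof (rule Bochner_Integration.integrable_bound)
    show "integrable lborel (\<lambda>x. B * norm (h x 0) powr p)" using i0 by simp
    show "(\<lambda>x. E (p / 2) k x 0) \<in> borel_measurable lborel"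
      using borel_measurable_continuous_onI[OF cont_E[of 0 "p / 2" k]] p by simp
    show "AE x in lborel. norm (E (p / 2) k x 0) \<le> norm (B * norm (h x 0) powr p)"
    proof (intro AE_I2)
      fix x
      have "0 \<le> E (p / 2) k x 0" using E_lower[of x 0] powr_ge_zero order.trans by blast
      then show "norm (E (p / 2) k x 0) \<le> norm (B * norm (h x 0) powr p)"
        using E_upper[of 0 x] by simp
    qed
  qed
  \<comment> \<open>The bound \<open>V\<close> is taken to be \<open>e\<^sup>2\<close>, for which
    the smallness condition holds with equality.\<close>
  have V: "9 * D * CARD('n) * sqrt (e\<^sup>2) \<le> 1" "M\<^sup>2 < e\<^sup>2"
    using e M by (auto simp: power_strict_mono)
  have "(\<integral>\<^sup>+x. ennreal (norm (h x t) powr p) \<partial>lborel) \<le> (\<integral>\<^sup>+x. ennreal (E (p / 2) k x t) \<partial>lborel)"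
    by (intro nn_integral_mono ennreal_leI E_lower)
  also have "\<dots> \<le> ennreal (\<integral>x. E (p / 2) k x 0 \<partial>lborel)"
    by (rule nn_integral_E_le[OF V(1) h M(1) V(2) qk t iE])
  also have "\<dots> \<le> ennreal (\<integral>x. B * norm (h x 0) powr p \<partial>lborel)"
    using i0 by (intro ennreal_leI integral_mono iE E_upper) auto
  finally have nn: "(\<integral>\<^sup>+x. ennreal (norm (h x t) powr p) \<partial>lborel) \<le> ennreal (B * (\<integral>x. norm (h x 0) powr p \<partial>lborel))"
    by simp
  have meas: "(\<lambda>x. norm (h x t) powr p) \<in> borel_measurable lborel"
    using meas_h[OF t] by measurable
  have it: "integrable lborel (\<lambda>x. norm (h x t) powr p)"
    using nn meas by (intro integrableI_bounded) (auto intro: order.strict_trans1)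
  have I0: "(\<integral>x. norm (h x 0) powr p \<partial>lborel) \<ge> 0" by (intro integral_nonneg_AE) auto
  have It: "(\<integral>x. norm (h x t) powr p \<partial>lborel) \<ge> 0" by (intro integral_nonneg_AE) auto
  have "(\<integral>x. norm (h x t) powr p \<partial>lborel) \<le> B * (\<integral>x. norm (h x 0) powr p \<partial>lborel)"
    using nn nn_integral_eq_integral[OF it] B1 I0 by (simp add: ennreal_le_iff)
  then have "Lp_norm p (\<lambda>x. h x t) \<le> (B * (\<integral>x. norm (h x 0) powr p \<partial>lborel)) powr (1 / p)"
    unfolding Lp_norm_def using It p by (intro powr_mono2) auto
  also have "\<dots> = B powr (1 / p) * Lp_norm p (\<lambda>x. h x 0)"
    unfolding Lp_norm_def using B1 I0 by (simp add: powr_mult)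
  also have "\<dots> \<le> B * Lp_norm p (\<lambda>x. h x 0)"
  proof (intro mult_right_mono)
    have "B powr (1 / p) \<le> B powr 1" using B1 p by (intro powr_mono) auto
    then show "B powr (1 / p) \<le> B" using B1 by simp
  qed (simp add: Lp_norm_def)
  finally show ?thesis using it meas_h[OF t] by (simp add: Lp_finite_def)
qed

text \<open>The smallness hypothesis covers positive times only; continuity in time extends it to
  the initial tensor.\<close>

lemma norm_bound_at_0:
  fixes h :: "real^'n::finite \<Rightarrow> real \<Rightarrow> real^'n^'n"
  assumes "C21 h" "\<And>x t. t > 0 \<Longrightarrow> norm (h x t) \<le> M"
  shows "norm (h x 0) \<le> M"
proof -
  have "((\<lambda>s. h x s) has_vector_derivative pdt h x 0) (at 0 within {0..})"
    using assms(1) unfolding C21_def by auto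
  then have "continuous (at 0 within {0..}) (\<lambda>s. h x s)"
    by (rule has_vector_derivative_continuous)
  then have "((\<lambda>s. h x s) \<longlongrightarrow> h x 0) (at 0 within {0..})" by (simp add: continuous_within)
  then have "((\<lambda>s. h x s) \<longlongrightarrow> h x 0) (at_right 0)" by (rule tendsto_within_subset) auto
  then have "((\<lambda>s. norm (h x s)) \<longlongrightarrow> norm (h x 0)) (at_right 0)" by (rule tendsto_norm)
  then show ?thesis
    by (rule tendsto_upperbound) (auto simp: eventually_at_right_less assms(2) intro: eventually_mono[OF eventually_at_right_less])
qed

text \<open>The strict inequality for the supremum norm appears as a bound \<open>M\<close> below
  \<open>eps\<close>; this gap is what makes room for the regularisation \<eta>. The witness for the
  second constant is 3, from \<open>ke\<close> in \<open>Lp_bound\<close>.\<close>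

theorem theorem5p1:
  "\<exists>eps C. eps > (0::real) \<and> C > (0::real) \<and>
     (\<forall>(h :: real^'n::finite \<Rightarrow> real \<Rightarrow> real^'n^'n) p.
        C21 h \<and> (\<forall>x t. t \<ge> 0 \<longrightarrow> transpose (h x t) = h x t) \<and> ricci_deturck h \<and>
        (\<exists>M < eps. \<forall>x t. t > 0 \<longrightarrow> norm (h x t) \<le> M) \<and>
        1 \<le> p \<and> Lp_finite p (\<lambda>x. h x 0)
        \<longrightarrow> (\<forall>t \<ge> 0. Lp_finite p (\<lambda>x. h x t) \<and>
                 Lp_norm p (\<lambda>x. h x t) \<le> C * Lp_norm p (\<lambda>x. h x 0) \<and>
                 (p \<ge> 2 \<longrightarrow> Lp_norm p (\<lambda>x. h x t) \<le> Lp_norm p (\<lambda>x. h x 0))))"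
proof -
  obtain C where C: "C \<ge> 1" "\<And>X::real^'n^'n. C * norm X \<le> 1 \<Longrightarrow>
     matrix_inv (mat 1 + X) ** (mat 1 + X) = mat 1 \<and> (mat 1 + X) ** matrix_inv (mat 1 + X) = mat 1 \<and>
     norm (matrix_inv (mat 1 + X)) \<le> C \<and> norm (matrix_inv (mat 1 + X) - mat 1) \<le> C * norm X"
    using matrix_inv_perturb by blast
  obtain K0 where K0: "\<And>(A :: real^'n^'n) (B :: real^'n^'n). norm (A ** B) \<le> norm A * norm B * K0"
    using bounded_bilinear.pos_bounded[OF bounded_bilinear_matrix_mult] by blast
  \<comment> \<open>Enlarged to at least 1, so that \<open>C * C * K * K\<close> dominates
    \<open>C\<close>.\<close>
  define K where "K = max 1 K0"
  have K: "norm (A ** B) \<le> norm A * norm B * K" for A B :: "real^'n^'n"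
    by (rule order.trans[OF K0]) (simp add: K_def mult_left_mono)
  \<comment> \<open>A copy of the locale constant \<open>D\<close>: the threshold has to be fixed
    before any solution, and hence before the locale can be interpreted.\<close>
  define D' where "D' = C * C * K * K + 5 * C\<^sup>2 * real CARD('n)^6"
  define n where "n = real CARD('n)"
  have n1: "n \<ge> 1" unfolding n_def by (simp add: Suc_leI)
  have "K \<ge> 1" by (simp add: K_def)
  then have "C * (C * K * K) \<ge> C * 1" using C(1) by (intro mult_left_mono) (auto intro!: mult_ge1_I)
  then have DC: "D' \<ge> C" by (simp add: D'_def mult_ac add_increasing2)
  \<comment> \<open>Exactly the value for which \<open>9 * D' * n * e = 1\<close>. Since
    \<open>D'\<close> is at least \<open>C\<close>, it also gives \<open>C * e \<le> 1\<close>,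
    which puts h into the range of the inverse estimates.\<close>
  define e where "e = 1 / (9 * D' * n)"
  have D0: "D' > 0" using DC C by linarith
  have e0: "e > 0" using D0 n1 by (simp add: e_def)
  have eD: "9 * D' * n * e = 1" using D0 n1 by (simp add: e_def)
  have "C * 1 \<le> (9 * D') * n" using DC C D0 n1 by (intro mult_mono) auto
  then have Ce: "C * e \<le> 1" using eD mult_right_mono[of C "9 * D' * n" e] e0 by simp
  show ?thesis
  proof (intro exI conjI allI impI)
    show "e > 0" by (rule e0)
    show "(3::real) > 0" by simp
    fix h :: "real^'n \<Rightarrow> real \<Rightarrow> real^'n^'n" and p t :: real
    assume *: "C21 h \<and> (\<forall>x t. t \<ge> 0 \<longrightarrow> transpose (h x t) = h x t) \<and> ricci_deturck h \<and>
        (\<exists>M < e. \<forall>x t. t > 0 \<longrightarrow> norm (h x t) \<le> M) \<and> 1 \<le> p \<and> Lp_finite p (\<lambda>x. h x 0)"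
      and t: "t \<ge> 0"
    then obtain M where M: "M < e" "\<And>x t. t > 0 \<Longrightarrow> norm (h x t) \<le> M" by blast
    have hM: "norm (h x t) \<le> M" if "t \<ge> 0" for x t
      using norm_bound_at_0[of h M x, OF _ M(2)] M(2)[of t x] * that by (cases "t = 0") auto
    have M0: "M \<ge> 0" using hM[of 0 undefined] norm_ge_zero order.trans by (metis order_refl)
    interpret small_ricci_deturck h C K
    proof
      fix x and t :: real assume "t \<ge> 0"
      then have "C * norm (h x t) \<le> C * e" using order.trans[OF hM less_imp_le[OF M(1)]] C by (intro mult_left_mono) auto
      then show "C * norm (h x t) \<le> 1" using Ce by linarith
    qed (use * C K in \<open>auto simp: K_def\<close>)
    have e': "9 * D * CARD('n) * e = 1"
      using eD unfolding D_def D'_def n_def .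
    note b = Lp_bound[OF e' M0 M(1) hM _ _ t]
    show "Lp_finite p (\<lambda>x. h x t)"
      using b[of p "if p \<ge> 2 then 1 else 3"] * by auto
    show le: "Lp_norm p (\<lambda>x. h x t) \<le> Lp_norm p (\<lambda>x. h x 0)" if "p \<ge> 2"
      using b[of p 1] * that by auto
    show "Lp_norm p (\<lambda>x. h x t) \<le> 3 * Lp_norm p (\<lambda>x. h x 0)"
    proof (cases "p \<ge> 2")
      case True
      moreover have "Lp_norm p (\<lambda>x. h x 0) \<ge> 0" by (simp add: Lp_norm_def)
      ultimately show ?thesis using le by linarith
    next
      case False
      then show ?thesis using b[of p 3] * by auto
    qed
  qed
qed

end
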